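(* Let $N\geq 3$ and let $r>0$ be such that $r<y_{\frac{N-4}{2}}$ if $N\geq 4$ and $r<\pi$ if $N=3$. (i) There exist $\kappa_1,\kappa_2>0$, depending only on $r$ and $N$, such that for all $x\in B_r\setminus\{0\}$, $$\kappa_1|x|^{4-N}\leq\Psi(x)-\Lambda(x)\leq\kappa_2|x|^{4-N}\quad\text{if }N\geq5,$$ $$\kappa_1\bigl|\ln|x|\bigr|\leq\Psi(x)-\Lambda(x)\leq\kappa_2\bigl|\ln|x|\bigr|\quad\text{if }N=4,$$ $$-\kappa_1|x|\geq\Psi(x)-\Lambda(x)\geq-\kappa_2|x|\quad\text{if }N=3.$$ (ii) For every multiindex $\alpha\in\mathbb{N}_0^N$ with $|\alpha|\geq1$, there exists $\kappa_3>0$, depending only on $|\alpha|$, $r$ and $N$, such that $$\bigl|\partial^\alpha(\Psi(x)-\Lambda(x))\bigr|\leq\kappa_3|x|^{4-N-|\alpha|}\quad\text{for all }x\in B_r\setminus\{0\}.$$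
   Context: $B_r$ is the open ball of radius $r$ centred at $0$ in $\mathbb{R}^N$. For $\nu\geq0$, $Y_\nu$ denotes the Bessel function of the second kind of order $\nu$ and $y_\nu$ its first positive zero. For $x\in\mathbb{R}^N\setminus\{0\}$, $$\Psi(x)=-\frac14(2\pi|x|)^{\frac{2-N}{2}}Y_{\frac{N-2}{2}}(|x|)$$ is the real part of the radial outgoing fundamental solution of the Helmholtz equation $-\Delta u-u=\delta_0$, and $$\Lambda(x)=\frac{1}{N(N-2)\omega_N}|x|^{2-N}$$ is the fundamental solution of Laplace's equation, where $\omega_N=\frac{2\pi^{N/2}}{N\Gamma(N/2)}$ is the volume of the unit ball of $\mathbb{R}^N$. *)

theory Defs
  imports "HOL-Analysis.Analysis"
begin

definition bessel_J :: "real \<Rightarrow> real \<Rightarrow> real" where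
  "bessel_J \<nu> t =
     (\<Sum>k. (-1) ^ k * rGamma (real k + \<nu> + 1) / fact k * (t / 2) powr (2 * real k + \<nu>))"

text \<open>
  The series is meant for \<open>t > 0\<close> and every real order: \<open>rGamma\<close> is the entire reciprocal of
  \<open>Gamma\<close>, so the terms in which \<open>Gamma\<close> has a pole vanish. At integer orders the defining
  quotient of \<open>Y\<^sub>\<nu>\<close> is \<open>0 / 0\<close>, and \<open>Y\<^sub>\<nu>\<close> is its limit with respect to the order.
\<close>

definition bessel_Y_quot :: "real \<Rightarrow> real \<Rightarrow> real" where
  "bessel_Y_quot \<mu> t = (bessel_J \<mu> t * cos (\<mu> * pi) - bessel_J (- \<mu>) t) / sin (\<mu> * pi)"

definition bessel_Y :: "real \<Rightarrow> real \<Rightarrow> real" where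
  "bessel_Y \<nu> t =
     (if \<nu> \<in> \<int> then Lim (at \<nu>) (\<lambda>\<mu>. bessel_Y_quot \<mu> t) else bessel_Y_quot \<nu> t)"

text \<open>
  For \<open>\<nu> \<ge> 0\<close> the infimum is attained: \<open>Y\<^sub>\<nu>\<close> is continuous on \<open>(0, \<infinity>)\<close>, oscillates at infinity
  and tends to \<open>-\<infinity>\<close> at \<open>0\<close>.
\<close>

definition bessel_Y_first_zero :: "real \<Rightarrow> real" where
  "bessel_Y_first_zero \<nu> = Inf {t. 0 < t \<and> bessel_Y \<nu> t = 0}"

definition Psi :: "real ^ 'n \<Rightarrow> real" where
  "Psi x = - (1 / 4) * (2 * pi * norm x) powr ((2 - real CARD('n)) / 2)
             * bessel_Y ((real CARD('n) - 2) / 2) (norm x)"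

text \<open>
  \<open>unit_ball_vol (real N)\<close> is \<open>\<omega>\<^sub>N\<close>; its definition \<open>\<pi>\<^bsup>N/2\<^esup> / \<Gamma>(N/2 + 1)\<close> agrees with
  \<open>2 \<pi>\<^bsup>N/2\<^esup> / (N \<Gamma>(N/2))\<close> by the functional equation of \<open>\<Gamma>\<close>.
\<close>

definition Lambda :: "real ^ 'n \<Rightarrow> real" where
  "Lambda x = 1 / (real CARD('n) * (real CARD('n) - 2) * unit_ball_vol (real CARD('n)))
                * norm x powr (2 - real CARD('n))"

definition partial_deriv :: "'n \<Rightarrow> (real ^ 'n \<Rightarrow> real) \<Rightarrow> real ^ 'n \<Rightarrow> real" where
  "partial_deriv i f x = deriv (\<lambda>t. f (x + t *\<^sub>R axis i 1)) 0"

text \<open>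
  The index type of \<open>real ^ 'n\<close> carries no order, so a numbering \<open>i\<^sub>1, \<dots>, i\<^sub>N\<close> of the coordinates
  is fixed once and for all; then \<open>\<partial>\<^sup>\<alpha> = \<partial>\<^bsub>i1\<^esub>\<^bsup>\<alpha>(i1)\<^esup> \<dots> \<partial>\<^bsub>iN\<^esub>\<^bsup>\<alpha>(iN)\<^esup>\<close>. For smooth functions the
  choice of numbering does not matter.
\<close>

definition coords :: "'n::finite list" where
  "coords = (SOME is. distinct is \<and> set is = UNIV)"

definition multi_deriv :: "('n::finite \<Rightarrow> nat) \<Rightarrow> (real ^ 'n \<Rightarrow> real) \<Rightarrow> real ^ 'n \<Rightarrow> real" where
  "multi_deriv \<alpha> f = foldr (\<lambda>i. partial_deriv i ^^ \<alpha> i) coords f"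

definition multi_order :: "('n::finite \<Rightarrow> nat) \<Rightarrow> nat" where
  "multi_order \<alpha> = (\<Sum>i\<in>UNIV. \<alpha> i)"

end

theory Submission
  imports Defs
begin

text \<open>
  Both fundamental solutions are radial, and their difference is governed by one function of one
  variable. Put \<open>\<nu> = (N - 2) / 2\<close> and \<open>G\<^sub>\<nu>(t) = t\<^sup>\<nu> Y\<^sub>\<nu>(t)\<close>. Then \<open>\<Psi>(x)\<close> is a negative multiple of
  \<open>t\<^sup>2\<^sup>-\<^sup>N G\<^sub>\<nu>(t)\<close> at \<open>t = |x|\<close>, and \<open>\<Lambda>(x)\<close> is the same expression with \<open>G\<^sub>\<nu>(t)\<close> replaced by its limit
  \<open>G\<^sub>\<nu>(0+)\<close>. So \<open>\<Psi> - \<Lambda>\<close> is a positive constant times \<open>t\<^sup>2\<^sup>-\<^sup>N D(t)\<close> with \<open>D = G\<^sub>\<nu>(0+) - G\<^sub>\<nu>\<close>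
  (\<open>Psi_minus_Lambda\<close>).

  \<^emph>\<open>Two-sided bounds.\<close> For \<open>N \<ge> 4\<close> the recurrence \<open>G\<^sub>\<nu>' = t G\<^sub>\<nu>\<^sub>-\<^sub>1\<close> (\<open>DERIV_weighted_Y\<close>) gives
  \<open>D' = - t G\<^sub>\<nu>\<^sub>-\<^sub>1\<close>. Below the first zero of \<open>Y\<^sub>\<nu>\<^sub>-\<^sub>1\<close> this does not vanish, and as \<open>D\<close> tends to zero at the
  origin, Rolle's theorem shows that \<open>D\<close> has no zero either (\<open>excess_nonzero\<close>). By l'Hopital's rule
  \<open>D(t) / t\<^sup>2\<close> has a positive limit at the origin if \<open>N \<ge> 5\<close>, and so has \<open>D(t) / (t\<^sup>2 |ln t|)\<close> if \<open>N = 4\<close>. A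
  continuous function without zeros and with a positive limit at the missing end point lies between
  two positive constants (\<open>bounds_from_limit_at_right_0\<close>). For \<open>N = 4\<close> the quotient makes sense on the
  whole ball only if \<open>r < 1\<close>, which holds because \<open>Y\<^sub>0\<close> has a zero in \<open>(0, 1]\<close>
  (\<open>bessel_Y_first_zero_0_le_1\<close>). For \<open>N = 3\<close> the function \<open>G\<^sub>\<nu>\<close> is a multiple of the cosine, and
  \<open>1 - cos t\<close> takes the place of \<open>D\<close>.

  \<^emph>\<open>Derivatives.\<close> The expansion \<open>G\<^sub>\<nu>(t) = A(t\<^sup>2) + t\<^sup>2\<^sup>\<nu> ln t B(t\<^sup>2)\<close> with entire \<open>A\<close> and \<open>B\<close>
  (\<open>weighted_Y_expansion\<close>) turns the difference into \<open>|x|\<^sup>4\<^sup>-\<^sup>N\<close> times an entire function of \<open>|x|\<^sup>2\<close> plus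
  \<open>ln |x|\<close> times another one, the latter being zero in odd dimensions (\<open>Psi_minus_Lambda_class\<close>).
  Functions of this shape are closed under partial derivatives. Each derivative costs one power of
  \<open>|x|\<close> in the first part, while the coefficient of the logarithm stays bounded. For even \<open>N\<close> the
  required bound after at least one derivative is \<open>|x|\<^sup>-\<^sup>1\<close> or worse, which dominates the logarithm.

  \<^emph>\<open>Integer orders.\<close> There \<open>Y\<^sub>\<nu>\<close> is a limit with respect to the order. As \<open>1 / \<Gamma>\<close> is differentiable
  everywhere with derivatives growing at most geometrically along unit steps (\<open>rGamma_growth\<close>), the
  series of \<open>J\<^sub>\<mu>\<close> may be differentiated termwise in \<open>\<mu>\<close> (\<open>DERIV_bessel_fps_order\<close>), and the limit becomes a
  ratio of derivatives (\<open>bessel_Y_nat\<close>). The recurrences pass to the differentiated series in the same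
  way.
\<close>

section \<open>Growth of the reciprocal Gamma function\<close>

abbreviation entire_fps :: "real fps \<Rightarrow> bool" where
  "entire_fps F \<equiv> fps_conv_radius F = \<infinity>"

text \<open>
  Unlike \<open>\<Gamma>\<close>, its reciprocal is differentiable at every real point, the poles of \<open>\<Gamma>\<close> included.
  This makes the Bessel series differentiable in its order, which is how \<open>Y\<^sub>\<nu>\<close> is reached at
  integer orders.
\<close>
lemma DERIV_rGamma: "((rGamma :: real \<Rightarrow> real) has_real_derivative deriv rGamma x) (at x within A)"
proof -
  have "(rGamma :: real \<Rightarrow> real) field_differentiable at x"
    using has_field_derivative_rGamma unfolding field_differentiable_def by blast
  then have "((rGamma :: real \<Rightarrow> real) has_real_derivative deriv rGamma x) (at x)"
    by (simp add: DERIV_deriv_iff_field_differentiable)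
  then show ?thesis
    by (rule has_field_derivative_at_within)
qed

lemma DERIV_rGamma_shift:
  fixes a x :: real
  shows "((\<lambda>x. rGamma (a + x + 1)) has_real_derivative deriv rGamma (a + x + 1)) (at x within A)"
proof -
  have "((\<lambda>x. a + x + 1) has_real_derivative 1) (at x within A)"
    by (auto intro!: derivative_eq_intros)
  from DERIV_chain2[OF DERIV_rGamma this] show ?thesis by simp
qed

text \<open>
  The functional equation \<open>x / \<Gamma>(x + 1) = 1 / \<Gamma>(x)\<close>, differentiated.
\<close>
lemma deriv_rGamma_plus1:
  fixes x :: real
  shows "x * deriv rGamma (x + 1) + rGamma (x + 1) = deriv rGamma x"
proof -
  have "((\<lambda>x. x * rGamma (x + 1)) has_real_derivative x * deriv rGamma (x + 1) + rGamma (x + 1)) (at x)"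
  proof -
    have "((\<lambda>x. rGamma (x + 1)) has_real_derivative deriv rGamma (x + 1)) (at x)"
      using DERIV_rGamma_shift[of 0] by simp
    from DERIV_mult[OF DERIV_ident this] show ?thesis by (simp add: mult_ac add_ac)
  qed
  then have "(rGamma has_real_derivative x * deriv rGamma (x + 1) + rGamma (x + 1)) (at x)"
    by (simp add: rGamma_plus1)
  then show ?thesis
    using DERIV_rGamma DERIV_unique by blast
qed

text \<open>
  The two functional equations show that one unit step beyond \<open>x \<ge> 1\<close> does not increase
  \<open>1 / \<Gamma>\<close> and increases its derivative by at most the previous value of \<open>1 / \<Gamma>\<close>. Geometric growth is
  crude, but harmless against the factor \<open>1 / k!\<close> of the Bessel series.
\<close>
lemma rGamma_doubling:
  fixes x :: real
  assumes "x \<ge> 1"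
  shows "\<bar>rGamma (x + real k)\<bar> + \<bar>deriv rGamma (x + real k)\<bar> \<le> 2 ^ k * (\<bar>rGamma x\<bar> + \<bar>deriv rGamma x\<bar>)"
proof (induction k)
  case (Suc k)
  define y where "y = x + real k"
  have y: "y \<ge> 1" using assms by (simp add: y_def)
  have scale: "\<bar>z\<bar> \<le> y * \<bar>z\<bar>" for z
    using mult_right_mono[OF y, of "\<bar>z\<bar>"] by simp
  have "\<bar>rGamma (y + 1)\<bar> \<le> \<bar>rGamma y\<bar>"
    using scale[of "rGamma (y + 1)"] y by (simp add: rGamma_plus1[of y, symmetric] abs_mult)
  moreover have "\<bar>deriv rGamma (y + 1)\<bar> \<le> \<bar>deriv rGamma y\<bar> + \<bar>rGamma (y + 1)\<bar>"
    using abs_triangle_ineq4[of "deriv rGamma y" "rGamma (y + 1)"] scale[of "deriv rGamma (y + 1)"] y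
      deriv_rGamma_plus1[of y] by (simp add: abs_mult algebra_simps)
  ultimately have "\<bar>rGamma (y + 1)\<bar> + \<bar>deriv rGamma (y + 1)\<bar> \<le> 2 * (\<bar>rGamma y\<bar> + \<bar>deriv rGamma y\<bar>)"
    using abs_ge_zero[of "deriv rGamma y"] unfolding distrib_left by linarith
  then show ?case
    using Suc by (simp add: y_def algebra_simps)
qed simp

text \<open>
  Uniformity in the order is what allows termwise differentiation of the Bessel series in the order.
  Only large \<open>k\<close> are considered: then \<open>x + k \<ge> 1\<close> on the whole interval, away from the poles
  of \<open>\<Gamma>\<close>.
\<close>
lemma rGamma_growth:
  fixes a b :: real
  obtains C :: real and K :: nat where
    "\<And>x k. x \<in> {a..b} \<Longrightarrow> k \<ge> K \<Longrightarrow> \<bar>rGamma (x + real k)\<bar> \<le> C * 2 ^ k"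
    "\<And>x k. x \<in> {a..b} \<Longrightarrow> k \<ge> K \<Longrightarrow> \<bar>deriv rGamma (x + real k)\<bar> \<le> C * 2 ^ k"
proof -
  \<comment> \<open>\<open>K\<close> unit steps carry the whole interval beyond \<open>1\<close>.\<close>
  define K where "K = nat \<lceil>1 - a\<rceil>"
  have K: "a + real K \<ge> 1" unfolding K_def by linarith
  let ?m = "\<lambda>x :: real. \<bar>rGamma x\<bar> + \<bar>deriv rGamma x\<bar>"
  let ?S = "{a + real K..b + real K}"
  have pos: "x \<notin> \<int>\<^sub>\<le>\<^sub>0" if "x \<in> ?S" for x
    using that K by (auto elim!: nonpos_Ints_cases)
  have "continuous_on ?S (\<lambda>x. - rGamma x * Digamma x)"
    using pos by (intro continuous_on_minus continuous_on_mult continuous_on_rGamma continuous_on_Polygamma) auto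
  moreover have "- rGamma x * Digamma x = deriv rGamma x" if "x \<in> ?S" for x
    using has_field_derivative_rGamma_no_nonpos_int[OF pos[OF that]] DERIV_rGamma DERIV_unique by blast
  ultimately have "continuous_on ?S (deriv rGamma :: real \<Rightarrow> real)"
    by (rule continuous_on_eq)
  then have "continuous_on ?S ?m"
    by (intro continuous_intros)
  then have "bdd_above (?m ` ?S)"
    by (intro bounded_imp_bdd_above compact_imp_bounded compact_continuous_image) auto
  then obtain C where C: "\<And>x. x \<in> ?S \<Longrightarrow> ?m x \<le> C"
    unfolding bdd_above_def by blast
  have main: "?m (x + real k) \<le> \<bar>C\<bar> * 2 ^ k" if "x \<in> {a..b}" "k \<ge> K" for x k
  proof -
    have "?m (x + real K + real (k - K)) \<le> 2 ^ (k - K) * ?m (x + real K)"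
      using that K by (intro rGamma_doubling) auto
    also have "\<dots> \<le> 2 ^ k * \<bar>C\<bar>"
      using that C[of "x + real K"] by (intro mult_mono power_increasing) auto
    finally show ?thesis using that by (simp add: of_nat_diff algebra_simps)
  qed
  have "\<bar>rGamma (x + real k)\<bar> \<le> \<bar>C\<bar> * 2 ^ k" "\<bar>deriv rGamma (x + real k)\<bar> \<le> \<bar>C\<bar> * 2 ^ k"
    if "x \<in> {a..b}" "k \<ge> K" for x k
    using main[OF that] abs_ge_zero[of "rGamma (x + real k)"] abs_ge_zero[of "deriv rGamma (x + real k)"]
    by linarith+
  then show thesis
    using that[of K "\<bar>C\<bar>"] by auto
qed

section \<open>Bessel functions of the first kind as functions of the order\<close>

text \<open>
  The regular factor of the Bessel function of the first kind:
  \<open>J\<^sub>\<mu>(t) = (t / 2)\<^sup>\<mu> W(t\<^sup>2)\<close> with \<open>W\<close> the sum of this series. Because \<open>1 / \<Gamma>\<close> has no poles, all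
  real orders are covered at once.
\<close>
definition bessel_fps :: "real \<Rightarrow> real fps" where
  "bessel_fps \<mu> = Abs_fps (\<lambda>k. (-1) ^ k * rGamma (real k + \<mu> + 1) / (fact k * 4 ^ k))"

text \<open>
  The coefficientwise derivative of \<^const>\<open>bessel_fps\<close> with respect to the order.
\<close>
definition bessel_fps' :: "real \<Rightarrow> real fps" where
  "bessel_fps' \<mu> = Abs_fps (\<lambda>k. (-1) ^ k * deriv rGamma (real k + \<mu> + 1) / (fact k * 4 ^ k))"

lemma summable_majorant: "summable (\<lambda>k. C * 2 ^ k / (fact k * 4 ^ k) * \<bar>s\<bar> ^ k :: real)"
proof -
  have "summable (\<lambda>k. C * ((\<bar>s\<bar> / 2) ^ k /\<^sub>R fact k))"
    by (intro summable_mult summable_exp_generic)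
  moreover have "C * ((\<bar>s\<bar> / 2) ^ k /\<^sub>R fact k) = C * 2 ^ k / (fact k * 4 ^ k) * \<bar>s\<bar> ^ k" for k
  proof -
    have "(4::real) ^ k = 2 ^ k * 2 ^ k" by (simp flip: power_mult_distrib)
    then show ?thesis by (simp add: field_simps power_divide)
  qed
  ultimately show ?thesis by (simp only:)
qed

lemma bessel_term_bound:
  fixes z :: real
  assumes "\<bar>z\<bar> \<le> C * 2 ^ k"
  shows "norm ((-1) ^ k * z / (fact k * 4 ^ k) * s ^ k) \<le> C * 2 ^ k / (fact k * 4 ^ k) * \<bar>s\<bar> ^ k"
proof -
  have "norm ((-1) ^ k * z / (fact k * 4 ^ k) * s ^ k) = \<bar>z\<bar> * (\<bar>s\<bar> ^ k / (fact k * 4 ^ k))"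
    by (simp add: abs_mult power_abs)
  also have "\<dots> \<le> (C * 2 ^ k) * (\<bar>s\<bar> ^ k / (fact k * 4 ^ k))"
    using assms by (intro mult_right_mono) auto
  finally show ?thesis by simp
qed

lemma entire_bessel_fps: "entire_fps (bessel_fps \<mu>)" "entire_fps (bessel_fps' \<mu>)"
proof -
  obtain C K where C: "\<And>k. k \<ge> K \<Longrightarrow> \<bar>rGamma (\<mu> + 1 + real k)\<bar> \<le> C * 2 ^ k"
    "\<And>k. k \<ge> K \<Longrightarrow> \<bar>deriv rGamma (\<mu> + 1 + real k)\<bar> \<le> C * 2 ^ k"
    using rGamma_growth[of "\<mu> + 1" "\<mu> + 1"] by (metis atLeastAtMost_singleton singletonI)
  have "summable (\<lambda>k. fps_nth (bessel_fps \<mu>) k * s ^ k)"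
       "summable (\<lambda>k. fps_nth (bessel_fps' \<mu>) k * s ^ k)" for s
    unfolding bessel_fps_def bessel_fps'_def fps_nth_Abs_fps using C
    by (intro summable_comparison_test[OF _ summable_majorant[of C s]] exI[of _ K] allI impI
          bessel_term_bound; simp add: add_ac)+
  then show "entire_fps (bessel_fps \<mu>)" "entire_fps (bessel_fps' \<mu>)"
    unfolding fps_conv_radius_def by (intro conv_radius_inftyI''; blast)+
qed

text \<open>
  For fixed \<open>s\<close> the sum is differentiated termwise in the order; the majorant of the differentiated
  series is uniform on a neighbourhood of \<open>\<mu>\<close> by the growth bound for the derivative of \<open>1 / \<Gamma>\<close>.
\<close>
lemma DERIV_bessel_fps_order:
  "((\<lambda>\<mu>. eval_fps (bessel_fps \<mu>) s) has_real_derivative eval_fps (bessel_fps' \<mu>) s) (at \<mu>)"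
proof -
  let ?S = "{\<mu> - 1..\<mu> + 1}"
  let ?f = "\<lambda>k \<mu>. (-1) ^ k * rGamma (real k + \<mu> + 1) / (fact k * 4 ^ k) * s ^ k"
  let ?f' = "\<lambda>k \<mu>. (-1) ^ k * deriv rGamma (real k + \<mu> + 1) / (fact k * 4 ^ k) * s ^ k"
  obtain C K where C:
    "\<And>x k. x \<in> {\<mu>..\<mu> + 2} \<Longrightarrow> k \<ge> K \<Longrightarrow> \<bar>deriv rGamma (x + real k)\<bar> \<le> C * 2 ^ k"
    using rGamma_growth[of "\<mu>" "\<mu> + 2"] by metis
  have "((\<lambda>\<mu>. \<Sum>k. ?f k \<mu>) has_real_derivative (\<Sum>k. ?f' k \<mu>)) (at \<mu>)"
  proof (rule has_field_derivative_series'(2)[of ?S _ _ \<mu>])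
    show "(?f k has_real_derivative ?f' k x) (at x within ?S)" for k x
      using DERIV_cmult[OF DERIV_rGamma_shift[of "real k" x ?S], of "(-1) ^ k / (fact k * 4 ^ k) * s ^ k"]
      by (simp add: mult_ac)
    show "uniformly_convergent_on ?S (\<lambda>n x. \<Sum>i<n. ?f' i x)"
    proof (rule Weierstrass_m_test'_ev[OF _ summable_majorant[of C s]])
      show "\<forall>\<^sub>F n in sequentially. \<forall>x\<in>?S. norm (?f' n x) \<le> C * 2 ^ n / (fact n * 4 ^ n) * \<bar>s\<bar> ^ n"
        using eventually_ge_at_top[of K]
      proof eventually_elim
        case (elim n)
        show ?case
          using C[of "x + 1" n for x] elim by (intro ballI bessel_term_bound) (simp add: add_ac)
      qed
    qed
    show "summable (\<lambda>k. ?f k \<mu>)"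
      using summable_fps[of s "bessel_fps \<mu>"] entire_bessel_fps(1)[of \<mu>] by (simp add: bessel_fps_def)
  qed auto
  then show ?thesis
    by (simp add: eval_fps_def bessel_fps_def bessel_fps'_def)
qed

lemma bessel_J_eq:
  assumes "t > 0"
  shows "bessel_J \<mu> t = (t / 2) powr \<mu> * eval_fps (bessel_fps \<mu>) (t\<^sup>2)"
proof -
  have "(-1) ^ k * rGamma (real k + \<mu> + 1) / fact k * (t / 2) powr (2 * real k + \<mu>) =
        (t / 2) powr \<mu> * (fps_nth (bessel_fps \<mu>) k * (t\<^sup>2) ^ k)" for k
  proof -
    have "(t / 2) powr (2 * real k + \<mu>) = (t / 2) powr \<mu> * (t / 2) ^ (2 * k)"
      using assms by (simp add: powr_add flip: powr_realpow)
    then show ?thesis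
      by (simp add: bessel_fps_def power_divide power_mult)
  qed
  moreover have "summable (\<lambda>k. fps_nth (bessel_fps \<mu>) k * (t\<^sup>2) ^ k)"
    by (intro summable_fps) (simp add: entire_bessel_fps)
  ultimately show ?thesis
    unfolding bessel_J_def eval_fps_def by (simp add: suminf_mult)
qed

text \<open>
  Series form of \<open>(t\<^sup>-\<^sup>\<mu> J\<^sub>\<mu>)' = - t\<^sup>-\<^sup>\<mu> J\<^sub>\<mu>\<^sub>+\<^sub>1\<close>, and its derivative in the order.
\<close>
lemma fps_deriv_bessel_fps:
  "fps_deriv (bessel_fps \<mu>) = fps_const (- 1 / 4) * bessel_fps (\<mu> + 1)"
  "fps_deriv (bessel_fps' \<mu>) = fps_const (- 1 / 4) * bessel_fps' (\<mu> + 1)"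
  unfolding bessel_fps_def bessel_fps'_def
  by (rule fps_ext; simp add: divide_simps del: of_nat_Suc; simp add: add_ac)+

lemma fps_nth_euler_operator:
  "fps_nth (fps_const c * F + fps_X * fps_deriv F) k = (real k + c) * fps_nth F k"
  by (cases k) (auto simp: algebra_simps)

text \<open>
  Series form of \<open>(t\<^sup>\<mu> J\<^sub>\<mu>)' = t\<^sup>\<mu> J\<^sub>\<mu>\<^sub>-\<^sub>1\<close>: the left-hand side multiplies the \<open>k\<close>-th coefficient by
  \<open>k + \<mu>\<close>, which lowers the argument of \<open>1 / \<Gamma>\<close> by one.
\<close>
lemma bessel_fps_lower_order:
  "fps_const \<mu> * bessel_fps \<mu> + fps_X * fps_deriv (bessel_fps \<mu>) = bessel_fps (\<mu> - 1)"
proof (rule fps_ext, unfold fps_nth_euler_operator)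
  fix k
  show "(real k + \<mu>) * fps_nth (bessel_fps \<mu>) k = fps_nth (bessel_fps (\<mu> - 1)) k"
    using rGamma_plus1[of "real k + \<mu>"] by (simp add: bessel_fps_def flip: mult.left_commute[of "(-1) ^ k"])
qed

text \<open>
  The preceding identity differentiated in \<open>\<mu>\<close>; the subtracted series comes from the factor
  \<open>k + \<mu>\<close>.
\<close>
lemma bessel_fps'_lower_order:
  "fps_const \<mu> * bessel_fps' \<mu> + fps_X * fps_deriv (bessel_fps' \<mu>) =
     bessel_fps' (\<mu> - 1) - bessel_fps \<mu>"
proof (rule fps_ext, unfold fps_nth_euler_operator)
  fix k
  have "deriv rGamma (real k + \<mu>) - rGamma (real k + \<mu> + 1) = (real k + \<mu>) * deriv rGamma (real k + \<mu> + 1)"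
    using deriv_rGamma_plus1[of "real k + \<mu>"] by simp
  then have "fps_nth (bessel_fps' (\<mu> - 1) - bessel_fps \<mu>) k
             = (-1) ^ k * ((real k + \<mu>) * deriv rGamma (real k + \<mu> + 1)) / (fact k * 4 ^ k)"
    by (simp add: bessel_fps_def bessel_fps'_def flip: diff_divide_distrib right_diff_distrib)
  then show "(real k + \<mu>) * fps_nth (bessel_fps' \<mu>) k = fps_nth (bessel_fps' (\<mu> - 1) - bessel_fps \<mu>) k"
    by (simp add: bessel_fps'_def mult_ac)
qed

section \<open>Bessel functions of the second kind at integer and half-odd orders\<close>

definition bessel_J_order_deriv :: "real \<Rightarrow> real \<Rightarrow> real" where
  "bessel_J_order_deriv \<mu> t = (t / 2) powr \<mu> *
     (ln (t / 2) * eval_fps (bessel_fps \<mu>) (t\<^sup>2) + eval_fps (bessel_fps' \<mu>) (t\<^sup>2))"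

lemma DERIV_bessel_J_order:
  assumes "t > 0"
  shows "((\<lambda>\<mu>. bessel_J \<mu> t) has_real_derivative bessel_J_order_deriv \<mu> t) (at \<mu>)"
proof -
  have "((\<lambda>\<mu>. (t / 2) powr \<mu>) has_real_derivative (t / 2) powr \<mu> * ln (t / 2)) (at \<mu>)"
    using assms by (auto intro!: derivative_eq_intros simp: powr_def)
  from DERIV_mult[OF this DERIV_bessel_fps_order[of "t\<^sup>2"]] show ?thesis
    using assms by (simp add: bessel_J_eq bessel_J_order_deriv_def algebra_simps)
qed

lemma rGamma_Suc_nat: "rGamma (real k + 1) = 1 / fact k"
  by (simp add: rGamma_inverse_Gamma Gamma_fact[symmetric] add_ac field_simps)

text \<open>
  At order \<open>-n\<close> the first \<open>n\<close> coefficients vanish together with \<open>1 / \<Gamma>\<close>, and the remaining ones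
  are those of order \<open>n\<close> up to a constant factor.
\<close>
lemma bessel_fps_minus_nat:
  "bessel_fps (- real n) = fps_const ((-1/4) ^ n) * (fps_X ^ n * bessel_fps (real n))"
proof (rule fps_ext)
  fix k
  show "fps_nth (bessel_fps (- real n)) k = fps_nth (fps_const ((-1/4) ^ n) * (fps_X ^ n * bessel_fps (real n))) k"
  proof (cases "k < n")
    case True
    then have "real k - real n + 1 = - of_nat (n - Suc k)"
      by (simp add: of_nat_diff)
    then have "real k - real n + 1 \<in> \<int>\<^sub>\<le>\<^sub>0"
      by (metis minus_of_nat_in_nonpos_Ints)
    then have "rGamma (real k - real n + 1) = 0"
      by (simp add: rGamma_eq_zero_iff)
    then show ?thesis
      using True by (simp add: bessel_fps_def fps_X_power_mult_nth)
  next
    case False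
    then obtain l where k: "k = n + l"
      by (metis le_add_diff_inverse not_less)
    then show ?thesis
      using rGamma_Suc_nat[of l] rGamma_Suc_nat[of k]
      by (simp add: bessel_fps_def fps_X_power_mult_nth power_add add_ac power_divide[of "-1" 4, simplified])
        (simp add: mult_ac)
  qed
qed

lemma eval_bessel_fps_minus_nat:
  "eval_fps (bessel_fps (- real n)) s = (-1/4) ^ n * (s ^ n * eval_fps (bessel_fps (real n)) s)"
  using entire_bessel_fps(1)[of "real n"] fps_conv_radius_mult[of "fps_X ^ n" "bessel_fps (real n)"]
  by (simp add: bessel_fps_minus_nat eval_fps_mult)

text \<open>
  This is why the numerator defining \<open>Y\<close> vanishes at integer orders.
\<close>
lemma bessel_J_minus_nat:
  assumes "t > 0"
  shows "bessel_J (- real n) t = (-1) ^ n * bessel_J (real n) t"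
proof -
  have "(-1/4) ^ n * (t\<^sup>2) ^ n = (-1) ^ n * ((t / 2) ^ n * (t / 2) ^ n)"
    unfolding power_mult_distrib[symmetric] by (simp add: power2_eq_square)
  moreover have "(t / 2) powr (- real n) * (t / 2) ^ n = 1"
    using assms by (simp add: powr_minus powr_realpow)
  moreover have "(t / 2) powr real n = (t / 2) ^ n"
    using assms by (simp add: powr_realpow)
  ultimately have "(t / 2) powr (- real n) * ((-1/4) ^ n * (t\<^sup>2) ^ n) = (-1) ^ n * (t / 2) powr real n"
    by (simp add: mult.left_commute)
  then show ?thesis
    using assms by (simp add: bessel_J_eq eval_bessel_fps_minus_nat mult_ac)
qed

text \<open>
  At an integer order the numerator and the denominator of the quotient both vanish and are
  differentiable in the order, so the limit is the ratio of their derivatives.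
\<close>
lemma bessel_Y_nat:
  assumes "t > 0"
  shows "bessel_Y (real n) t =
    (bessel_J_order_deriv (real n) t + (-1) ^ n * bessel_J_order_deriv (- real n) t) / pi"
proof -
  let ?\<nu> = "real n"
  let ?num = "\<lambda>\<mu>. bessel_J \<mu> t * cos (\<mu> * pi) - bessel_J (- \<mu>) t"
  let ?D = "bessel_J_order_deriv ?\<nu> t * (-1) ^ n + bessel_J_order_deriv (- ?\<nu>) t"
  have cs: "cos (?\<nu> * pi) = (-1) ^ n" "sin (?\<nu> * pi) = 0"
    by (simp_all add: cos_npi)
  have "((\<lambda>\<mu>. bessel_J (- \<mu>) t) has_real_derivative bessel_J_order_deriv (- ?\<nu>) t * (- 1)) (at ?\<nu>)"
    by (rule DERIV_chain2[OF DERIV_bessel_J_order[OF assms]]) (auto intro!: derivative_eq_intros)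
  moreover have "((\<lambda>\<mu>. cos (\<mu> * pi)) has_real_derivative 0) (at ?\<nu>)"
    by (rule derivative_eq_intros refl | simp add: cs)+
  ultimately have "(?num has_real_derivative ?D) (at ?\<nu>)"
    using DERIV_bessel_J_order[OF assms, of ?\<nu>] cs
    by (auto intro!: derivative_eq_intros)
  then have num: "((\<lambda>\<mu>. ?num \<mu> / (\<mu> - ?\<nu>)) \<longlongrightarrow> ?D) (at ?\<nu>)"
    using bessel_J_minus_nat[OF assms, of n] by (simp add: has_field_derivative_iff cs)
  have "((\<lambda>\<mu>. sin (\<mu> * pi)) has_real_derivative (-1) ^ n * pi) (at ?\<nu>)"
    by (rule derivative_eq_intros refl | simp add: cs)+
  then have den: "((\<lambda>\<mu>. sin (\<mu> * pi) / (\<mu> - ?\<nu>)) \<longlongrightarrow> (-1) ^ n * pi) (at ?\<nu>)"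
    by (simp add: has_field_derivative_iff cs)
  have "((\<lambda>\<mu>. bessel_Y_quot \<mu> t) \<longlongrightarrow> ?D / ((-1) ^ n * pi)) (at ?\<nu>)"
  proof (rule Lim_transform_eventually[OF tendsto_divide[OF num den]])
    show "\<forall>\<^sub>F \<mu> in at ?\<nu>. ?num \<mu> / (\<mu> - ?\<nu>) / (sin (\<mu> * pi) / (\<mu> - ?\<nu>)) = bessel_Y_quot \<mu> t"
      using eventually_neq_at_within by (rule eventually_mono) (simp add: bessel_Y_quot_def)
  qed simp
  then have "bessel_Y ?\<nu> t = ?D / ((-1) ^ n * pi)"
    unfolding bessel_Y_def by (simp add: tendsto_Lim)
  also have "\<dots> = (bessel_J_order_deriv ?\<nu> t + (-1) ^ n * bessel_J_order_deriv (- ?\<nu>) t) / pi"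
    by (cases "even n") (simp_all add: field_simps)
  finally show ?thesis .
qed

text \<open>
  The weight cancels the leading singularity \<open>t\<^sup>-\<^sup>\<nu>\<close> of \<open>Y\<^sub>\<nu>\<close>, so that for \<open>\<nu> > 0\<close> there is a finite limit
  at the origin, and it is the normalization in which lowering the order is differentiation.
\<close>
definition weighted_Y :: "real \<Rightarrow> real \<Rightarrow> real" where
  "weighted_Y \<nu> t = t powr \<nu> * bessel_Y \<nu> t"

text \<open>
  The orders \<open>n\<close> and \<open>-n\<close> contribute the same logarithmic term, whence the factor two in front of
  \<open>ln (t / 2)\<close>.
\<close>
lemma weighted_Y_nat:
  assumes "t > 0"
  shows "weighted_Y (real n) t =
    (t ^ (2 * n) / 2 ^ n * (2 * ln (t / 2) * eval_fps (bessel_fps (real n)) (t\<^sup>2) + eval_fps (bessel_fps' (real n)) (t\<^sup>2))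
     + (-2) ^ n * eval_fps (bessel_fps' (- real n)) (t\<^sup>2)) / pi"
proof -
  have 1: "t ^ n * (t / 2) powr real n = t ^ (2 * n) / 2 ^ n"
  proof -
    have "(t / 2) powr real n = (t / 2) ^ n"
      using assms by (simp add: powr_realpow)
    then show ?thesis
      by (simp add: power_divide power_mult power2_eq_square power_mult_distrib)
  qed
  have 2: "(-1) ^ n * (t ^ n * (t / 2) powr - real n) = (-2) ^ n"
  proof -
    have "(t / 2) powr - real n = (2 / t) ^ n"
      using assms by (simp add: powr_minus powr_realpow flip: power_inverse)
    then have "(-1) ^ n * (t ^ n * (t / 2) powr - real n) = (-1 * (t * (2 / t))) ^ n"
      by (simp only: power_mult_distrib)
    then show ?thesis using assms by simp
  qed
  have 3: "(-2 :: real) ^ n * ((-1/4) ^ n * (t\<^sup>2) ^ n) = t ^ (2 * n) / 2 ^ n"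
    unfolding power_mult_distrib[symmetric] power_mult power_divide[symmetric] by simp
  have "weighted_Y (real n) t =
    (t ^ n * (t / 2) powr real n * (ln (t / 2) * eval_fps (bessel_fps (real n)) (t\<^sup>2) + eval_fps (bessel_fps' (real n)) (t\<^sup>2))
     + (-1) ^ n * (t ^ n * (t / 2) powr - real n) *
       (ln (t / 2) * eval_fps (bessel_fps (- real n)) (t\<^sup>2) + eval_fps (bessel_fps' (- real n)) (t\<^sup>2))) / pi"
    using assms by (simp add: weighted_Y_def bessel_Y_nat powr_realpow bessel_J_order_deriv_def distrib_left mult.assoc mult.left_commute)
  also have "\<dots> = (t ^ (2 * n) / 2 ^ n * (ln (t / 2) * eval_fps (bessel_fps (real n)) (t\<^sup>2) + eval_fps (bessel_fps' (real n)) (t\<^sup>2))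
     + (ln (t / 2) * (((-2) ^ n * ((-1/4) ^ n * (t\<^sup>2) ^ n)) * eval_fps (bessel_fps (real n)) (t\<^sup>2)) + (-2) ^ n * eval_fps (bessel_fps' (- real n)) (t\<^sup>2))) / pi"
    unfolding 1 2 eval_bessel_fps_minus_nat by (simp add: algebra_simps)
  also have "\<dots> = (t ^ (2 * n) / 2 ^ n * (2 * ln (t / 2) * eval_fps (bessel_fps (real n)) (t\<^sup>2) + eval_fps (bessel_fps' (real n)) (t\<^sup>2))
     + (-2) ^ n * eval_fps (bessel_fps' (- real n)) (t\<^sup>2)) / pi"
    unfolding 3 by (simp add: algebra_simps)
  finally show ?thesis .
qed

lemma cos_half_odd: "cos ((real m + 1/2) * pi) = 0"
  by (simp add: ring_distribs cos_add)

lemma sin_half_odd: "sin ((real m + 1/2) * pi) = (-1) ^ m"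
  by (simp add: ring_distribs sin_add)

lemma half_odd_not_int: "real m + 1/2 \<notin> \<int>"
proof
  assume "real m + 1/2 \<in> \<int>"
  then obtain k :: int where "real m + 1/2 = k" by (auto elim: Ints_cases)
  then have "real_of_int (2 * k) = real_of_int (2 * int m + 1)" by simp
  then have "2 * k = 2 * int m + 1" by (simp only: of_int_eq_iff)
  then show False by presburger
qed

text \<open>
  At half-odd orders the cosine in the definition of \<open>Y\<^sub>\<nu>\<close> vanishes and only \<open>J\<^sub>-\<^sub>\<nu>\<close> survives: there is
  no logarithm.
\<close>
lemma weighted_Y_half_odd:
  assumes "t > 0"
  shows "weighted_Y (real m + 1/2) t =
    - ((-1) ^ m) * 2 powr (real m + 1/2) * eval_fps (bessel_fps (- (real m + 1/2))) (t\<^sup>2)"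
proof -
  have "bessel_Y (real m + 1/2) t = - ((-1) ^ m) * bessel_J (- (real m + 1/2)) t"
    unfolding bessel_Y_def bessel_Y_quot_def
    using half_odd_not_int[of m] cos_half_odd[of m] sin_half_odd[of m]
    by (cases "even m") simp_all
  moreover have "t powr (real m + 1/2) * (t / 2) powr (- (real m + 1/2)) = 2 powr (real m + 1/2)"
    using assms by (simp add: powr_divide powr_minus field_simps flip: powr_add)
  ultimately show ?thesis
    using assms unfolding weighted_Y_def by (simp add: bessel_J_eq flip: mult.assoc)
qed

section \<open>Lowering the order and expanding at the origin\<close>

lemma DERIV_eval_fps_square:
  fixes F :: "real fps"
  assumes "entire_fps F"
  shows "((\<lambda>t. eval_fps F (t\<^sup>2)) has_real_derivative 2 * t * eval_fps (fps_deriv F) (t\<^sup>2)) (at t)"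
proof -
  have "((\<lambda>t. t\<^sup>2) has_real_derivative 2 * t) (at t)"
    by (auto intro!: derivative_eq_intros)
  from DERIV_chain2[OF has_field_derivative_eval_fps this] assms show ?thesis
    by (simp add: mult.commute)
qed

lemma eval_fps_cmult:
  assumes "entire_fps F"
  shows "eval_fps (fps_const c * F) s = c * eval_fps F (s :: real)"
  using assms by (simp add: eval_fps_mult)

lemma entire_fps_cmult: "entire_fps F \<Longrightarrow> entire_fps (fps_const c * F)"
  using fps_conv_radius_mult[of "fps_const c" F] by auto

lemma eval_fps_euler_operator:
  assumes "entire_fps F"
  shows "eval_fps (fps_const c * F + fps_X * fps_deriv F) s = c * eval_fps F s + s * eval_fps (fps_deriv F) (s :: real)"
proof -
  have d: "entire_fps (fps_deriv F)"
    using fps_conv_radius_deriv[of F] assms by simp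
  have "entire_fps (fps_const c * F)" "entire_fps (fps_X * fps_deriv F)"
    using fps_conv_radius_mult[of "fps_const c" F] fps_conv_radius_mult[of fps_X "fps_deriv F"] assms d by auto
  then show ?thesis
    using assms d by (simp add: eval_fps_add eval_fps_mult)
qed

text \<open>
  The recurrence \<open>(t\<^sup>\<nu> Y\<^sub>\<nu>)' = t \<cdot> t\<^sup>\<nu>\<^sup>-\<^sup>1 Y\<^sub>\<nu>\<^sub>-\<^sub>1\<close> at integer orders, read off from the identities for the
  two series. The term produced by differentiating the logarithm cancels the term subtracted in
  \<open>bessel_fps'_lower_order\<close>.
\<close>
lemma DERIV_weighted_Y_nat:
  assumes "t > 0"
  shows "(weighted_Y (real (Suc m)) has_real_derivative t * weighted_Y (real m) t) (at t)"
proof -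
  let ?n = "Suc m"
  let ?W = "\<lambda>\<mu> t. eval_fps (bessel_fps \<mu>) (t\<^sup>2)" and ?V = "\<lambda>\<mu> t. eval_fps (bessel_fps' \<mu>) (t\<^sup>2)"
  let ?W' = "\<lambda>\<mu> t. eval_fps (fps_deriv (bessel_fps \<mu>)) (t\<^sup>2)"
  let ?V' = "\<lambda>\<mu> t. eval_fps (fps_deriv (bessel_fps' \<mu>)) (t\<^sup>2)"
  let ?F = "\<lambda>t. (t ^ (2 * ?n) / 2 ^ ?n * (2 * ln (t / 2) * ?W ?n t + ?V ?n t) + (-2) ^ ?n * ?V (- real ?n) t) / pi"
  have W: "real ?n * ?W ?n t + t\<^sup>2 * ?W' ?n t = ?W m t"
    using eval_fps_euler_operator[OF entire_bessel_fps(1), of ?n ?n "t\<^sup>2"]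
    by (simp add: bessel_fps_lower_order)
  have V: "real ?n * ?V ?n t + t\<^sup>2 * ?V' ?n t = ?V m t - ?W ?n t"
    using eval_fps_euler_operator[OF entire_bessel_fps(2), of ?n ?n "t\<^sup>2"]
    by (simp add: bessel_fps'_lower_order eval_fps_diff entire_bessel_fps)
  have V_neg: "?V' (- real ?n) t = - 1 / 4 * ?V (- real m) t"
    by (simp only: fps_deriv_bessel_fps)
       (simp add: eval_fps_mult entire_bessel_fps)
  have "(?F has_real_derivative
    ((2 * ?n) * t ^ (2 * m + 1) / 2 ^ ?n * (2 * ln (t / 2) * ?W ?n t + ?V ?n t) +
     t ^ (2 * ?n) / 2 ^ ?n * ((2 / t) * ?W ?n t + 2 * ln (t / 2) * (2 * t * ?W' ?n t) + 2 * t * ?V' ?n t)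
     + (-2) ^ ?n * (2 * t * ?V' (- real ?n) t)) / pi) (at t)" (is "(_ has_real_derivative ?D) _")
  proof -
    have "((\<lambda>t. (p t / 2 ^ ?n * (2 * ln (t / 2) * w t + v t) + d * u t) / pi) has_real_derivative
      (p' / 2 ^ ?n * (2 * ln (t / 2) * w t + v t) + p t / 2 ^ ?n * ((2 / t) * w t + 2 * ln (t / 2) * w' + v') + d * u') / pi) (at t)"
      if "(p has_real_derivative p') (at t)" "(w has_real_derivative w') (at t)"
         "(v has_real_derivative v') (at t)" "(u has_real_derivative u') (at t)" for p w v u p' w' v' u' d
      using assms that by (auto intro!: derivative_eq_intros simp del: power_Suc simp: add_divide_distrib[symmetric] mult.commute)
    moreover have "((\<lambda>t. t ^ (2 * ?n)) has_real_derivative (2 * ?n) * t ^ (2 * m + 1)) (at t)"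
      using DERIV_pow[of "2 * ?n" t] by simp
    ultimately show ?thesis
      using DERIV_eval_fps_square entire_bessel_fps by blast
  qed
  also have "?D = (t ^ (2 * m + 1) / 2 ^ m * (2 * ln (t / 2) * ?W m t + ?V m t)
                   + t * ((-2) ^ m * ?V (- real m) t)) / pi"
  proof -
    have "t ^ (2 * m + 1) / 2 ^ m * (2 * ln (t / 2) * ?W m t + ?V m t) =
      t ^ (2 * m + 1) / 2 ^ m * (2 * ln (t / 2) * (real ?n * ?W ?n t + t\<^sup>2 * ?W' ?n t) +
        (real ?n * ?V ?n t + t\<^sup>2 * ?V' ?n t) + ?W ?n t)"
      unfolding W V by simp
    also have "\<dots> = (2 * ?n) * t ^ (2 * m + 1) / 2 ^ ?n * (2 * ln (t / 2) * ?W ?n t + ?V ?n t) +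
     t ^ (2 * ?n) / 2 ^ ?n * ((2 / t) * ?W ?n t + 2 * ln (t / 2) * (2 * t * ?W' ?n t) + 2 * t * ?V' ?n t)"
      using assms by (simp add: field_simps power2_eq_square)
    finally show ?thesis unfolding V_neg by simp
  qed
  also have "\<dots> = t * weighted_Y (real m) t"
    using assms by (simp add: weighted_Y_nat algebra_simps add_divide_distrib)
  finally have "(?F has_real_derivative t * weighted_Y (real m) t) (at t)" .
  then show ?thesis
    by (rule has_field_derivative_transform_within_open[where S = "{0<..}"])
       (use assms in \<open>auto simp only: weighted_Y_nat open_greaterThan greaterThan_iff\<close>)
qed

lemma DERIV_weighted_Y_half_odd:
  assumes "t > 0"
  shows "(weighted_Y (real (Suc m) + 1/2) has_real_derivative t * weighted_Y (real m + 1/2) t) (at t)"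
proof -
  let ?\<nu> = "real (Suc m) + 1/2"
  let ?F = "\<lambda>t. - ((-1) ^ Suc m) * 2 powr ?\<nu> * eval_fps (bessel_fps (- ?\<nu>)) (t\<^sup>2)"
  have "(?F has_real_derivative - ((-1) ^ Suc m) * 2 powr ?\<nu> *
      (2 * t * eval_fps (fps_deriv (bessel_fps (- ?\<nu>))) (t\<^sup>2))) (at t)" (is "(_ has_real_derivative ?D) _")
    by (intro DERIV_cmult DERIV_eval_fps_square entire_bessel_fps)
  also have "?D = - ((-1) ^ m) * (2 powr ?\<nu> / 2) * t * eval_fps (bessel_fps (- (real m + 1/2))) (t\<^sup>2)"
  proof -
    have "- ?\<nu> + 1 = - (real m + 1/2)" by simp
    then show ?thesis
      by (simp only: fps_deriv_bessel_fps eval_fps_cmult entire_bessel_fps) simp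
  qed
  also have "2 powr ?\<nu> / 2 = 2 powr (real m + 1/2)"
    using powr_add[of 2 1 "real m + 1/2"] by (simp add: add_ac)
  also have "- ((-1) ^ m) * 2 powr (real m + 1/2) * t * eval_fps (bessel_fps (- (real m + 1/2))) (t\<^sup>2)
     = t * weighted_Y (real m + 1/2) t"
    using assms by (simp only: weighted_Y_half_odd mult_ac)
  finally have "(?F has_real_derivative t * weighted_Y (real m + 1/2) t) (at t)" .
  then show ?thesis
    by (rule has_field_derivative_transform_within_open[where S = "{0<..}"])
       (use assms in \<open>auto simp only: weighted_Y_half_odd open_greaterThan greaterThan_iff\<close>)
qed

lemma half_nat_cases:
  obtains m where "j = 2 * m" "real j / 2 = real m" | m where "j = 2 * m + 1" "real j / 2 = real m + 1/2"
  by (cases "even j") (auto elim!: evenE oddE)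

text \<open>
  Orders are written as \<open>j / 2\<close> so that even and odd dimensions are treated together: lowering the
  order by one means lowering the dimension by two.
\<close>
lemma DERIV_weighted_Y:
  assumes "t > 0"
  shows "(weighted_Y (real (j + 2) / 2) has_real_derivative t * weighted_Y (real j / 2) t) (at t)"
proof (cases j rule: half_nat_cases)
  case (1 m)
  then have "real (j + 2) / 2 = real (Suc m)" by simp
  then show ?thesis using DERIV_weighted_Y_nat[OF assms, of m] 1(2) by (simp only:)
next
  case (2 m)
  then have "real (j + 2) / 2 = real (Suc m) + 1/2" by simp
  then show ?thesis using DERIV_weighted_Y_half_odd[OF assms, of m] 2(2) by (simp only:)
qed

lemma rGamma_reflection_real:
  fixes z :: real
  shows "rGamma z * rGamma (1 - z) = sin (pi * z) / pi"
proof -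
  have "rGamma (complex_of_real z) * rGamma (complex_of_real (1 - z)) = complex_of_real (sin (pi * z) / pi)"
    using rGamma_reflection_complex[of "complex_of_real z"]
    by (simp add: sin_of_real flip: of_real_mult)
  then show ?thesis
    unfolding rGamma_complex_of_real of_real_mult[symmetric] of_real_eq_iff .
qed

text \<open>
  Euler's reflection formula; it identifies the constant term of the expansion at half-odd orders.
\<close>
lemma rGamma_half_odd:
  "rGamma (1 - (real m + 1/2)) = (-1) ^ m * Gamma (real m + 1/2) / pi"
proof -
  let ?z = "real m + 1/2"
  have "rGamma ?z * rGamma (1 - ?z) = sin (?z * pi) / pi"
    using rGamma_reflection_real[of ?z] by (simp only: mult.commute[of pi])
  then have "rGamma ?z * rGamma (1 - ?z) = (-1) ^ m / pi"
    by (simp only: sin_half_odd)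
  moreover have "Gamma ?z * rGamma ?z = 1"
    using Gamma_real_pos[of ?z] unfolding rGamma_inverse_Gamma[of ?z] by (intro right_inverse) linarith
  then have "rGamma (1 - ?z) = Gamma ?z * (rGamma ?z * rGamma (1 - ?z))"
    by (simp only: mult.assoc[symmetric] mult_1_left)
  ultimately show ?thesis
    by (simp only: times_divide_eq_right times_divide_eq_left mult.commute)
qed

text \<open>
  The normal form at the origin: an even entire function plus a logarithm times another one, the
  latter being absent for half-odd orders. The constant term of \<open>A\<close> is what the fundamental solution
  of Laplace's equation cancels. At integer order \<open>m > 0\<close> it comes from the derivative of \<open>1 / \<Gamma>\<close> at
  its zero \<open>1 - m\<close>, at half-odd order from the reflection formula. At order \<open>0\<close> the logarithm
  dominates instead.
\<close>
lemma weighted_Y_expansion: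
  obtains A B :: "real fps" where
    "entire_fps A" "entire_fps B" "odd j \<Longrightarrow> B = 0"
    "j > 0 \<Longrightarrow> fps_nth A 0 = - (2 powr (real j / 2) * Gamma (real j / 2) / pi)"
    "j = 0 \<Longrightarrow> fps_nth B 0 = 2 / pi"
    "\<And>t. t > 0 \<Longrightarrow> weighted_Y (real j / 2) t = eval_fps A (t\<^sup>2) + t ^ j * ln t * eval_fps B (t\<^sup>2)"
proof (cases j rule: half_nat_cases)
  case (1 m)
  let ?c = "fps_const :: real \<Rightarrow> real fps"
  define P where "P = bessel_fps' m - ?c (2 * ln 2) * bessel_fps m"
  define A where "A = ?c (1 / (2 ^ m * pi)) * (fps_X ^ m * P) + ?c ((-2) ^ m / pi) * bessel_fps' (- real m)"
  define B where "B = ?c (2 / (2 ^ m * pi)) * bessel_fps m"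
  have P: "entire_fps P"
    unfolding P_def using fps_conv_radius_diff[of "bessel_fps' m" "?c (2 * ln 2) * bessel_fps m"]
    by (simp add: entire_fps_cmult entire_bessel_fps)
  have XP: "entire_fps (fps_X ^ m * P)"
    using fps_conv_radius_mult[of "fps_X ^ m" P] P by simp
  have A: "entire_fps A"
    unfolding A_def using fps_conv_radius_add[of "?c (1 / (2 ^ m * pi)) * (fps_X ^ m * P)" "?c ((-2) ^ m / pi) * bessel_fps' (- real m)"]
    by (simp add: entire_fps_cmult entire_bessel_fps XP)
  have B: "entire_fps B"
    unfolding B_def by (simp add: entire_fps_cmult entire_bessel_fps)
  show thesis
  proof (rule that[OF A B])
    show "odd j \<Longrightarrow> B = 0" using 1 by simp
    show "j = 0 \<Longrightarrow> fps_nth B 0 = 2 / pi"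
      using 1 by (simp add: B_def bessel_fps_def)
    show "fps_nth A 0 = - (2 powr (real j / 2) * Gamma (real j / 2) / pi)" if j: "j > 0"
    proof -
      \<comment> \<open>Here \<open>1 / \<Gamma>\<close> has a simple zero at \<open>1 - m = - k\<close>, so only its derivative contributes.\<close>
      obtain k where k: "m = Suc k" using j 1 by (cases m) auto
      have "deriv rGamma (1 - real m) = (-1) ^ k * fact k"
        using has_field_derivative_rGamma_nonpos_int[of k, where ?'a = real and A = UNIV]
        by (intro DERIV_imp_deriv) (simp add: k)
      moreover have p: "2 powr real m = 2 ^ m"
        by (simp add: powr_realpow)
      moreover have "Gamma (real m) = fact k"
        using Gamma_fact[of k, where ?'a = real] by (simp add: k add_ac)
      moreover have "(-2 :: real) ^ m * (-1) ^ k = - (2 ^ m)"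
        unfolding k power_Suc by (simp add: power_mult_distrib[symmetric])
      ultimately show ?thesis
        unfolding 1(2) p using k by (simp add: A_def bessel_fps'_def fps_X_power_mult_nth add_ac)
    qed
    show "weighted_Y (real j / 2) t = eval_fps A (t\<^sup>2) + t ^ j * ln t * eval_fps B (t\<^sup>2)" if "t > 0" for t
    proof -
      let ?W = "eval_fps (bessel_fps m) (t\<^sup>2)" and ?V = "eval_fps (bessel_fps' m) (t\<^sup>2)"
      have eP: "eval_fps P (t\<^sup>2) = ?V - 2 * ln 2 * ?W"
        by (simp add: P_def eval_fps_diff eval_fps_mult entire_fps_cmult entire_bessel_fps)
      have eA: "eval_fps A (t\<^sup>2) = 1 / (2 ^ m * pi) * (t ^ j * (?V - 2 * ln 2 * ?W)) + (-2) ^ m / pi * eval_fps (bessel_fps' (- real m)) (t\<^sup>2)"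
        by (simp add: A_def eval_fps_add eval_fps_mult entire_fps_cmult entire_bessel_fps XP P eP 1(1) power_mult)
      have eB: "eval_fps B (t\<^sup>2) = 2 / (2 ^ m * pi) * ?W"
        by (simp add: B_def eval_fps_mult entire_bessel_fps)
      have "weighted_Y (real j / 2) t = (t ^ j / 2 ^ m * (2 * (ln t - ln 2) * ?W + ?V) + (-2) ^ m * eval_fps (bessel_fps' (- real m)) (t\<^sup>2)) / pi"
        using that unfolding 1(2) by (simp add: weighted_Y_nat ln_div 1(1))
      then show ?thesis
        unfolding eA eB by (simp add: field_simps)
    qed
  qed
next
  case (2 m)
  let ?\<nu> = "real m + 1/2"
  define A where "A = fps_const (- ((-1) ^ m) * 2 powr ?\<nu>) * bessel_fps (- ?\<nu>)"
  show thesis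
  proof (rule that[of A 0])
    show "entire_fps A"
      unfolding A_def by (intro entire_fps_cmult entire_bessel_fps)
    show "fps_nth A 0 = - (2 powr (real j / 2) * Gamma (real j / 2) / pi)"
      using rGamma_half_odd[of m] unfolding 2(2) by (simp add: A_def bessel_fps_def add_ac)
    show "weighted_Y (real j / 2) t = eval_fps A (t\<^sup>2) + t ^ j * ln t * eval_fps 0 (t\<^sup>2)" if "t > 0" for t
      unfolding 2(2) using that by (simp only: weighted_Y_half_odd A_def) (simp add: eval_fps_mult entire_bessel_fps)
  qed (use 2 in auto)
qed

section \<open>Functions with a power or logarithmic singularity at the origin\<close>

lemma axis_line_nth: "(x + t *\<^sub>R axis i 1) $ j = x $ j + t * (if i = j then 1 else 0)" for x :: "real ^ 'n"
  by (simp add: axis_def)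

text \<open>
  On a coordinate line the squared norm is a quadratic polynomial.
\<close>
lemma DERIV_norm_axis:
  fixes x :: "real ^ 'n"
  assumes "x \<noteq> 0"
  shows "((\<lambda>t. norm (x + t *\<^sub>R axis i 1)) has_real_derivative x $ i / norm x) (at 0)"
proof -
  have "norm (x + t *\<^sub>R axis i 1) = sqrt ((norm x)\<^sup>2 + 2 * t * x $ i + t\<^sup>2)" for t
    unfolding norm_eq_sqrt_inner
    by (simp add: inner_add_left inner_add_right inner_axis inner_axis' power2_eq_square algebra_simps)
  moreover have "((\<lambda>t. sqrt ((norm x)\<^sup>2 + 2 * t * x $ i + t\<^sup>2)) has_real_derivative x $ i / norm x) (at 0)"
    using assms by (auto intro!: derivative_eq_intros simp: field_simps)
  ultimately show ?thesis by simp
qed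

lemma eventually_axis_line_nz:
  fixes x :: "real ^ 'n"
  assumes "x \<noteq> 0"
  shows "\<forall>\<^sub>F t in nhds 0. x + t *\<^sub>R axis i 1 \<noteq> 0"
proof -
  have "((\<lambda>t. x + t *\<^sub>R axis i 1) \<longlongrightarrow> x + 0 *\<^sub>R axis i 1) (nhds 0)"
    by (intro tendsto_intros filterlim_ident)
  then show ?thesis
    using assms by (intro tendsto_imp_eventually_ne[where c = x]) simp_all
qed

lemma DERIV_axis_line_cong:
  fixes f :: "real ^ 'n \<Rightarrow> real"
  assumes "x \<noteq> 0" "\<And>y. y \<noteq> 0 \<Longrightarrow> f y = g y"
    "((\<lambda>t. f (x + t *\<^sub>R axis i 1)) has_real_derivative d) (at 0)"
  shows "((\<lambda>t. g (x + t *\<^sub>R axis i 1)) has_real_derivative d) (at 0)"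
proof -
  have "\<forall>\<^sub>F t in nhds 0. f (x + t *\<^sub>R axis i 1) = g (x + t *\<^sub>R axis i 1)"
    using eventually_axis_line_nz[OF assms(1), of i] by eventually_elim (rule assms(2))
  then show ?thesis
    using assms(3) by (subst (asm) DERIV_cong_ev[OF refl _ refl]) simp_all
qed

lemma DERIV_eval_fps_norm_square:
  fixes x :: "real ^ 'n"
  assumes "entire_fps F" "x \<noteq> 0"
  shows "((\<lambda>t. eval_fps F ((norm (x + t *\<^sub>R axis i 1))\<^sup>2)) has_real_derivative
       eval_fps (fps_deriv F) ((norm x)\<^sup>2) * (2 * x $ i)) (at 0)"
proof -
  have "(eval_fps F has_real_derivative eval_fps (fps_deriv F) ((norm x)\<^sup>2)) (at ((norm (x + 0 *\<^sub>R axis i 1))\<^sup>2))"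
    using has_field_derivative_eval_fps[of "(norm x)\<^sup>2" F UNIV] assms by simp
  moreover have "((\<lambda>t. (norm (x + t *\<^sub>R axis i 1))\<^sup>2) has_real_derivative 2 * x $ i) (at 0)"
    using DERIV_power[OF DERIV_norm_axis[OF assms(2), of i], of 2] assms(2) by simp
  ultimately show ?thesis by (rule DERIV_chain2)
qed

text \<open>
  Functions that are smooth away from the origin and of size \<open>O(|x|\<^sup>p)\<close> near it, given by explicit
  generators so that a partial derivative falls into the same family with \<open>p - 1\<close>. The class collects
  functions of order at least \<open>p\<close>: multiplication by a coordinate raises the order, and \<open>weaken\<close> lets
  terms of different orders be added. By \<open>cong\<close> the value at the origin is irrelevant.
\<close>
inductive singular_class :: "real \<Rightarrow> (real ^ 'n::finite \<Rightarrow> real) \<Rightarrow> bool" where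
  radial: "entire_fps F \<Longrightarrow> singular_class p (\<lambda>x. norm x powr p * eval_fps F ((norm x)\<^sup>2))"
| coord: "singular_class p f \<Longrightarrow> singular_class (p + 1) (\<lambda>x. x $ i * f x)"
| add: "singular_class p f \<Longrightarrow> singular_class p g \<Longrightarrow> singular_class p (\<lambda>x. f x + g x)"
| weaken: "singular_class p f \<Longrightarrow> q \<le> p \<Longrightarrow> singular_class q f"
| cong: "singular_class p f \<Longrightarrow> (\<And>x. x \<noteq> 0 \<Longrightarrow> g x = f x) \<Longrightarrow> singular_class p g"

text \<open>
  The coefficients of the logarithm. They contain no negative power of the norm and differentiation
  creates none, so that all their derivatives are bounded near the origin.
\<close>
inductive regular_class :: "(real ^ 'n::finite \<Rightarrow> real) \<Rightarrow> bool" where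
  radial: "entire_fps F \<Longrightarrow> regular_class (\<lambda>x. eval_fps F ((norm x)\<^sup>2))"
| coord: "regular_class f \<Longrightarrow> regular_class (\<lambda>x. x $ i * f x)"
| add: "regular_class f \<Longrightarrow> regular_class g \<Longrightarrow> regular_class (\<lambda>x. f x + g x)"

lemma singular_class_bound:
  fixes f :: "real ^ 'n::finite \<Rightarrow> real"
  assumes "singular_class p f" "r > 0"
  shows "\<exists>C\<ge>0. \<forall>x. x \<noteq> 0 \<longrightarrow> norm x < r \<longrightarrow> \<bar>f x\<bar> \<le> C * norm x powr p"
  using assms(1)
proof induction
  case (radial F p)
  have "continuous_on {0..r\<^sup>2} (eval_fps F)"
    using radial by (intro continuous_on_eval_fps') auto
  then have "bounded (eval_fps F ` {0..r\<^sup>2})"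
    by (intro compact_imp_bounded compact_continuous_image) auto
  then obtain C where C: "\<And>s. s \<in> {0..r\<^sup>2} \<Longrightarrow> \<bar>eval_fps F s\<bar> \<le> C"
    unfolding bounded_iff real_norm_def by blast
  have "0 \<le> C" using C[of 0] by auto
  moreover have "\<bar>norm x powr p * eval_fps F ((norm x)\<^sup>2)\<bar> \<le> C * norm x powr p" if "norm x < r" for x :: "real ^ 'n"
  proof -
    have "(norm x)\<^sup>2 \<in> {0..r\<^sup>2}" using that by (auto intro: power_mono)
    from mult_right_mono[OF C[OF this], of "norm x powr p"] show ?thesis
      by (simp add: abs_mult mult.commute)
  qed
  ultimately show ?case by blast
next
  case (coord p f i)
  then obtain C where C: "C \<ge> 0" "\<And>x. x \<noteq> 0 \<Longrightarrow> norm x < r \<Longrightarrow> \<bar>f x\<bar> \<le> C * norm x powr p"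
    by blast
  have "\<bar>x $ i * f x\<bar> \<le> C * norm x powr (p + 1)" if "x \<noteq> 0" "norm x < r" for x
  proof -
    have "\<bar>x $ i * f x\<bar> \<le> norm x * (C * norm x powr p)"
      unfolding abs_mult using C(2)[OF that] component_le_norm_cart[of x i] by (intro mult_mono) auto
    then show ?thesis by (simp add: powr_add mult_ac)
  qed
  then show ?case using C(1) by blast
next
  case (add p f g)
  then obtain C D where C: "C \<ge> 0" "\<And>x. x \<noteq> 0 \<Longrightarrow> norm x < r \<Longrightarrow> \<bar>f x\<bar> \<le> C * norm x powr p"
    and D: "D \<ge> 0" "\<And>x. x \<noteq> 0 \<Longrightarrow> norm x < r \<Longrightarrow> \<bar>g x\<bar> \<le> D * norm x powr p"
    by blast
  have "\<bar>f x + g x\<bar> \<le> (C + D) * norm x powr p" if "x \<noteq> 0" "norm x < r" for x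
    using C(2)[OF that] D(2)[OF that] by (simp add: distrib_right)
  then show ?case using C(1) D(1) add_nonneg_nonneg by blast
next
  case (weaken p f q)
  then obtain C where C: "C \<ge> 0" "\<And>x. x \<noteq> 0 \<Longrightarrow> norm x < r \<Longrightarrow> \<bar>f x\<bar> \<le> C * norm x powr p"
    by blast
  have "\<bar>f x\<bar> \<le> (C * r powr (p - q)) * norm x powr q" if "x \<noteq> 0" "norm x < r" for x
  proof -
    have "norm x powr p = norm x powr (p - q) * norm x powr q"
      by (simp flip: powr_add)
    moreover have "norm x powr (p - q) \<le> r powr (p - q)"
      using that weaken by (intro powr_mono2) auto
    ultimately have "C * norm x powr p \<le> C * (r powr (p - q) * norm x powr q)"
      using C(1) by (intro mult_left_mono) (auto intro: mult_right_mono)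
    then show ?thesis using C(2)[OF that] by simp
  qed
  then show ?case using C(1) by (intro exI[of _ "C * r powr (p - q)"]) auto
next
  case (cong p f g)
  then show ?case by simp
qed

text \<open>
  A radial generator has a single generator as its partial derivative,
  \<open>\<partial>\<^sub>i (|x|\<^sup>p F(|x|\<^sup>2)) = x\<^sub>i |x|\<^sup>p\<^sup>-\<^sup>2 H(|x|\<^sup>2)\<close> with \<open>H(s) = p F(s) + 2 s F'(s)\<close>; the other constructors
  follow by the product and sum rules.
\<close>
lemma singular_class_DERIV:
  fixes f :: "real ^ 'n::finite \<Rightarrow> real"
  assumes "singular_class p f"
  shows "\<exists>g. singular_class (p - 1) g \<and>
    (\<forall>x. x \<noteq> 0 \<longrightarrow> ((\<lambda>t. f (x + t *\<^sub>R axis i 1)) has_real_derivative g x) (at 0))"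
  using assms
proof induction
  case (radial F p)
  let ?H = "fps_const p * F + fps_const 2 * (fps_X * fps_deriv F)"
  have d: "entire_fps (fps_deriv F)"
    using fps_conv_radius_deriv[of F] radial by simp
  then have xd: "entire_fps (fps_X * fps_deriv F)"
    using fps_conv_radius_mult[of fps_X "fps_deriv F"] by simp
  have H: "entire_fps ?H"
    using fps_conv_radius_add[of "fps_const p * F" "fps_const 2 * (fps_X * fps_deriv F)"] entire_fps_cmult[OF radial] entire_fps_cmult[OF xd] by simp
  have eH: "eval_fps ?H s = p * eval_fps F s + 2 * s * eval_fps (fps_deriv F) s" for s
    using radial d xd by (simp add: eval_fps_add eval_fps_mult entire_fps_cmult)
  let ?g = "\<lambda>x :: real ^ 'n. x $ i * (norm x powr (p - 2) * eval_fps ?H ((norm x)\<^sup>2))"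
  have "singular_class (p - 2 + 1) ?g"
    by (intro singular_class.coord singular_class.radial H)
  moreover have "((\<lambda>t. norm (x + t *\<^sub>R axis i 1) powr p * eval_fps F ((norm (x + t *\<^sub>R axis i 1))\<^sup>2))
      has_real_derivative ?g x) (at 0)" if x: "x \<noteq> 0" for x :: "real ^ 'n"
  proof -
    note n = DERIV_norm_axis[OF x, of i]
    have nx: "norm x > 0" using x by simp
    have d1: "((\<lambda>t. norm (x + t *\<^sub>R axis i 1) powr p) has_real_derivative p * norm x powr (p - 1) * (x $ i / norm x)) (at 0)"
      using DERIV_fun_powr[OF n, of p] nx by simp
    note d2 = DERIV_eval_fps_norm_square[OF radial x, of i]
    have "((\<lambda>t. norm (x + t *\<^sub>R axis i 1) powr p * eval_fps F ((norm (x + t *\<^sub>R axis i 1))\<^sup>2))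
      has_real_derivative p * norm x powr (p - 1) * (x $ i / norm x) * eval_fps F ((norm x)\<^sup>2) +
        eval_fps (fps_deriv F) ((norm x)\<^sup>2) * (2 * x $ i) * norm x powr p) (at 0)"
      using DERIV_mult[OF d1 d2] by simp
    moreover have "norm x powr (p - 1) = norm x powr (p - 2) * norm x" "norm x powr p = norm x powr (p - 2) * (norm x)\<^sup>2"
      using nx powr_add[of "norm x" "p - 2" 1] powr_add[of "norm x" "p - 2" 2]
      by (simp_all add: powr_numeral)
    ultimately show ?thesis
      unfolding eH using nx by (simp add: algebra_simps power2_eq_square)
  qed
  ultimately show ?case by auto
next
  case (coord p f j)
  then obtain g where g: "singular_class (p - 1) g"
    "\<And>x. x \<noteq> 0 \<Longrightarrow> ((\<lambda>t. f (x + t *\<^sub>R axis i 1)) has_real_derivative g x) (at 0)"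
    by blast
  let ?\<delta> = "if i = j then 1 else 0 :: real"
  let ?h = "\<lambda>x. ?\<delta> * f x + x $ j * g x"
  have jg: "singular_class p (\<lambda>x. x $ j * g x)"
    using singular_class.coord[OF g(1), of j] by simp
  have "singular_class p ?h"
    using jg singular_class.add[OF coord.hyps jg] by (cases "i = j") auto
  moreover have "((\<lambda>t. (x + t *\<^sub>R axis i 1) $ j * f (x + t *\<^sub>R axis i 1)) has_real_derivative ?h x) (at 0)" if "x \<noteq> 0" for x
  proof -
    have "((\<lambda>t. x $ j + t * ?\<delta>) has_real_derivative ?\<delta>) (at 0)"
      by (auto intro!: derivative_eq_intros)
    from DERIV_mult[OF this g(2)[OF that]] show ?thesis
      unfolding axis_line_nth by (simp add: mult_ac)
  qed
  ultimately show ?case by auto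
next
  case (add p f g)
  then obtain f' g' where "singular_class (p - 1) f'" "singular_class (p - 1) g'"
    "\<And>x. x \<noteq> 0 \<Longrightarrow> ((\<lambda>t. f (x + t *\<^sub>R axis i 1)) has_real_derivative f' x) (at 0)"
    "\<And>x. x \<noteq> 0 \<Longrightarrow> ((\<lambda>t. g (x + t *\<^sub>R axis i 1)) has_real_derivative g' x) (at 0)"
    by blast
  then show ?case
    by (intro exI[of _ "\<lambda>x. f' x + g' x"]) (auto intro!: singular_class.add DERIV_add)
next
  case (weaken p f q)
  then show ?case
    by (meson singular_class.weaken diff_right_mono)
next
  case (cong p f g)
  then obtain f' where f': "singular_class (p - 1) f'"
    "\<And>x. x \<noteq> 0 \<Longrightarrow> ((\<lambda>t. f (x + t *\<^sub>R axis i 1)) has_real_derivative f' x) (at 0)"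
    by blast
  have "((\<lambda>t. g (x + t *\<^sub>R axis i 1)) has_real_derivative f' x) (at 0)" if "x \<noteq> 0" for x
    using cong.hyps(2) by (intro DERIV_axis_line_cong[OF that _ f'(2)[OF that]]) simp
  then show ?case using f'(1) by blast
qed

lemma singular_class_partial_deriv:
  assumes "singular_class p f"
  shows "singular_class (p - 1) (partial_deriv i f)"
proof -
  obtain g where g: "singular_class (p - 1) g"
    "\<And>x. x \<noteq> 0 \<Longrightarrow> ((\<lambda>t. f (x + t *\<^sub>R axis i 1)) has_real_derivative g x) (at 0)"
    using singular_class_DERIV[OF assms, of i] by blast
  have "partial_deriv i f x = g x" if "x \<noteq> 0" for x
    unfolding partial_deriv_def using g(2)[OF that] by (rule DERIV_imp_deriv)
  with g(1) show ?thesis by (rule singular_class.cong)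
qed

lemma singular_class_powr_mult:
  fixes f :: "real ^ 'n::finite \<Rightarrow> real"
  assumes "singular_class p f"
  shows "singular_class (p + q) (\<lambda>x. norm x powr q * f x)"
  using assms
proof induction
  case (radial F p)
  then have "singular_class (p + q) (\<lambda>x :: real ^ 'n. norm x powr (p + q) * eval_fps F ((norm x)\<^sup>2))"
    by (rule singular_class.radial)
  then show ?case by (simp add: powr_add mult_ac)
next
  case (coord p f i)
  then show ?case
    using singular_class.coord[of "p + q" "\<lambda>x. norm x powr q * f x" i] by (simp add: mult_ac add_ac)
next
  case (add p f g)
  then show ?case
    using singular_class.add[of "p + q" "\<lambda>x. norm x powr q * f x" "\<lambda>x. norm x powr q * g x"]
    by (simp add: distrib_left)
next
  case (weaken p f p')
  then show ?case
    by (auto intro: singular_class.weaken)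
next
  case (cong p f g)
  show ?case by (rule singular_class.cong[OF cong.IH]) (simp add: cong.hyps)
qed

lemma regular_imp_singular_class: "regular_class f \<Longrightarrow> singular_class 0 f"
proof (induction rule: regular_class.induct)
  case (radial F)
  show ?case by (rule singular_class.cong[OF singular_class.radial[OF radial, of 0]]) simp
next
  case (coord f i)
  show ?case by (rule singular_class.weaken[OF singular_class.coord[OF coord.IH]]) simp
next
  case (add f g)
  then show ?case by (intro singular_class.add)
qed

lemma regular_class_DERIV:
  fixes f :: "real ^ 'n::finite \<Rightarrow> real"
  assumes "regular_class f"
  shows "\<exists>g. regular_class g \<and>
    (\<forall>x. x \<noteq> 0 \<longrightarrow> ((\<lambda>t. f (x + t *\<^sub>R axis i 1)) has_real_derivative g x) (at 0))"
  using assms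
proof induction
  case (radial F)
  let ?H = "fps_const 2 * fps_deriv F"
  have d: "entire_fps (fps_deriv F)"
    using fps_conv_radius_deriv[of F] radial by simp
  have H: "entire_fps ?H"
    using fps_conv_radius_mult[of "fps_const 2" "fps_deriv F"] d by simp
  let ?g = "\<lambda>x :: real ^ 'n. x $ i * eval_fps ?H ((norm x)\<^sup>2)"
  have "regular_class ?g"
    by (intro regular_class.coord regular_class.radial H)
  moreover have "((\<lambda>t. eval_fps F ((norm (x + t *\<^sub>R axis i 1))\<^sup>2)) has_real_derivative ?g x) (at 0)"
    if x: "x \<noteq> 0" for x :: "real ^ 'n"
  proof -
    have "((\<lambda>t. eval_fps F ((norm (x + t *\<^sub>R axis i 1))\<^sup>2)) has_real_derivative
       eval_fps (fps_deriv F) ((norm x)\<^sup>2) * (2 * x $ i)) (at 0)"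
      by (rule DERIV_eval_fps_norm_square[OF radial x])
    then show ?thesis
      using d by (simp add: eval_fps_mult mult_ac)
  qed
  ultimately show ?case by auto
next
  case (coord f j)
  then obtain g where g: "regular_class g"
    "\<And>x. x \<noteq> 0 \<Longrightarrow> ((\<lambda>t. f (x + t *\<^sub>R axis i 1)) has_real_derivative g x) (at 0)"
    by blast
  let ?\<delta> = "if i = j then 1 else 0 :: real"
  let ?h = "\<lambda>x. ?\<delta> * f x + x $ j * g x"
  have jg: "regular_class (\<lambda>x. x $ j * g x)"
    using regular_class.coord[OF g(1), of j] by simp
  have "regular_class ?h"
    using jg regular_class.add[OF coord.hyps jg] by (cases "i = j") auto
  moreover have "((\<lambda>t. (x + t *\<^sub>R axis i 1) $ j * f (x + t *\<^sub>R axis i 1)) has_real_derivative ?h x) (at 0)" if "x \<noteq> 0" for x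
  proof -
    have "((\<lambda>t. x $ j + t * ?\<delta>) has_real_derivative ?\<delta>) (at 0)"
      by (auto intro!: derivative_eq_intros)
    from DERIV_mult[OF this g(2)[OF that]] show ?thesis
      unfolding axis_line_nth by (simp add: mult_ac)
  qed
  ultimately show ?case by auto
next
  case (add f g)
  then obtain f' g' where "regular_class f'" "regular_class g'"
    "\<And>x. x \<noteq> 0 \<Longrightarrow> ((\<lambda>t. f (x + t *\<^sub>R axis i 1)) has_real_derivative f' x) (at 0)"
    "\<And>x. x \<noteq> 0 \<Longrightarrow> ((\<lambda>t. g (x + t *\<^sub>R axis i 1)) has_real_derivative g' x) (at 0)"
    by blast
  then show ?case
    by (intro exI[of _ "\<lambda>x. f' x + g' x"]) (auto intro!: regular_class.add DERIV_add)
qed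

text \<open>
  Differentiating \<open>ln |x|\<close> produces a factor of order \<open>-1\<close>, which the singular part can absorb at order
  \<open>p - 1\<close> when \<open>p \<le> 0\<close>.
\<close>
definition log_singular_class :: "real \<Rightarrow> (real ^ 'n::finite \<Rightarrow> real) \<Rightarrow> bool" where
  "log_singular_class p F \<longleftrightarrow> p \<le> 0 \<and>
     (\<exists>f h. regular_class f \<and> singular_class p h \<and> (\<forall>x. x \<noteq> 0 \<longrightarrow> F x = f x * ln (norm x) + h x))"

lemma log_singular_class_partial_deriv:
  fixes F :: "real ^ 'n \<Rightarrow> real"
  assumes "log_singular_class p F"
  shows "log_singular_class (p - 1) (partial_deriv i F)"
proof -
  obtain f h where p: "p \<le> 0" and f: "regular_class f" and h: "singular_class p h"
    and F: "\<And>x. x \<noteq> 0 \<Longrightarrow> F x = f x * ln (norm x) + h x"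
    using assms unfolding log_singular_class_def by blast
  obtain f' where f': "regular_class f'"
    "\<And>x. x \<noteq> 0 \<Longrightarrow> ((\<lambda>t. f (x + t *\<^sub>R axis i 1)) has_real_derivative f' x) (at 0)"
    using regular_class_DERIV[OF f, of i] by blast
  obtain h' where h': "singular_class (p - 1) h'"
    "\<And>x. x \<noteq> 0 \<Longrightarrow> ((\<lambda>t. h (x + t *\<^sub>R axis i 1)) has_real_derivative h' x) (at 0)"
    using singular_class_DERIV[OF h, of i] by blast
  let ?k = "\<lambda>x. x $ i * (norm x powr (-2) * f x)"
  have "singular_class (0 + (-2) + 1) ?k"
    by (intro singular_class.coord singular_class_powr_mult regular_imp_singular_class f)
  then have "singular_class (p - 1) ?k"
    by (rule singular_class.weaken) (use p in simp)
  then have "singular_class (p - 1) (\<lambda>x. ?k x + h' x)"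
    using h'(1) by (rule singular_class.add)
  moreover have "partial_deriv i F x = f' x * ln (norm x) + (?k x + h' x)" if x: "x \<noteq> 0" for x
  proof -
    have "(ln has_real_derivative 1 / norm x) (at (norm (x + 0 *\<^sub>R axis i 1)))"
      using DERIV_ln_divide[of "norm x"] x by simp
    from DERIV_chain2[OF this DERIV_norm_axis[OF x]]
    have "((\<lambda>t. ln (norm (x + t *\<^sub>R axis i 1))) has_real_derivative (1 / norm x) * (x $ i / norm x)) (at 0)" .
    from DERIV_add[OF DERIV_mult[OF f'(2)[OF x] this] h'(2)[OF x]]
    have "((\<lambda>t. f (x + t *\<^sub>R axis i 1) * ln (norm (x + t *\<^sub>R axis i 1)) + h (x + t *\<^sub>R axis i 1)) has_real_derivative
            f' x * ln (norm x) + (?k x + h' x)) (at 0)"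
      using x by (simp add: powr_minus powr_numeral power2_eq_square divide_simps mult_ac add_ac)
    from DERIV_axis_line_cong[OF x F[symmetric] this] show ?thesis
      unfolding partial_deriv_def by (rule DERIV_imp_deriv)
  qed
  ultimately show ?thesis
    unfolding log_singular_class_def using p f'(1) by (intro conjI exI[of _ f'] exI[of _ "\<lambda>x. ?k x + h' x"]) auto
qed

lemma abs_ln_le_inverse:
  fixes t :: real
  assumes "t > 0"
  shows "\<bar>ln t\<bar> \<le> t + 1 / t"
proof -
  have "ln t \<le> t - 1" "- ln t \<le> 1 / t - 1" "1 / t > 0"
    using ln_le_minus_one[of t] ln_le_minus_one[of "1 / t"] assms by (auto simp: ln_div)
  then show ?thesis using assms by linarith
qed

text \<open>
  A single power \<open>|x|\<^sup>-\<^sup>1\<close> already dominates the logarithm. For \<open>p = 0\<close> the bound fails, which is why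
  the logarithm stays visible in dimension four as long as no derivative is taken.
\<close>
lemma log_singular_class_bound:
  assumes "log_singular_class p F" "p \<le> -1" "r > 0"
  shows "\<exists>C\<ge>0. \<forall>x. x \<noteq> 0 \<longrightarrow> norm x < r \<longrightarrow> \<bar>F x\<bar> \<le> C * norm x powr p"
proof -
  obtain f h where f: "regular_class f" and h: "singular_class p h"
    and F: "\<And>x. x \<noteq> 0 \<Longrightarrow> F x = f x * ln (norm x) + h x"
    using assms(1) unfolding log_singular_class_def by blast
  obtain C where C: "C \<ge> 0" "\<And>x. x \<noteq> 0 \<Longrightarrow> norm x < r \<Longrightarrow> \<bar>f x\<bar> \<le> C * norm x powr 0"
    using singular_class_bound[OF regular_imp_singular_class[OF f] assms(3)] by blast
  obtain D where D: "D \<ge> 0" "\<And>x. x \<noteq> 0 \<Longrightarrow> norm x < r \<Longrightarrow> \<bar>h x\<bar> \<le> D * norm x powr p"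
    using singular_class_bound[OF h assms(3)] by blast
  \<comment> \<open>On the ball \<open>|x| + 1/|x| = (|x|\<^sup>2 + 1) |x|\<^sup>-\<^sup>1\<^sup>-\<^sup>p |x|\<^sup>p\<close>, and \<open>-1 - p \<ge> 0\<close>.\<close>
  define K where "K = (r\<^sup>2 + 1) * r powr (- 1 - p)"
  have "\<bar>F x\<bar> \<le> (C * K + D) * norm x powr p" if x: "x \<noteq> 0" "norm x < r" for x
  proof -
    have nx: "norm x > 0" using x by simp
    have "\<bar>ln (norm x)\<bar> \<le> norm x + 1 / norm x"
      by (rule abs_ln_le_inverse[OF nx])
    also have "\<dots> = ((norm x)\<^sup>2 + 1) * norm x powr (- 1 - p) * norm x powr p"
    proof -
      have "norm x powr (- 1 - p) * norm x powr p = 1 / norm x"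
        using powr_add[of "norm x" "- 1 - p" p] nx by (simp add: powr_minus divide_inverse)
      then show ?thesis
        using nx by (simp add: mult.assoc) (simp add: field_simps power2_eq_square)
    qed
    also have "\<dots> \<le> K * norm x powr p"
      unfolding K_def using x assms(2) by (intro mult_right_mono mult_mono add_right_mono power_mono powr_mono2) auto
    finally have ln: "\<bar>ln (norm x)\<bar> \<le> K * norm x powr p" .
    have "\<bar>f x\<bar> \<le> C" using C(2)[OF x] nx by simp
    then have "\<bar>f x * ln (norm x)\<bar> \<le> C * (K * norm x powr p)"
      unfolding abs_mult using ln C(1) by (intro mult_mono) auto
    then show ?thesis
      using D(2)[OF x] F[OF x(1)] by (simp add: algebra_simps)
  qed
  moreover have "C * K + D \<ge> 0" using C(1) D(1) by (simp add: K_def)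
  ultimately show ?thesis by blast
qed

lemma multi_deriv_class:
  fixes F :: "real ^ 'n::finite \<Rightarrow> real"
  assumes closed: "\<And>p F i. P p F \<Longrightarrow> P (p - 1) (partial_deriv i F)"
    and "P p F"
  shows "P (p - real (multi_order \<alpha>)) (multi_deriv \<alpha> F)"
proof -
  have iter: "P (q - real k) ((partial_deriv i ^^ k) G)" if "P q G" for q k i and G :: "real ^ 'n \<Rightarrow> real"
  proof (induction k)
    case (Suc k)
    from closed[OF this] show ?case by (simp add: algebra_simps)
  qed (use that in simp)
  have "P (p - real (\<Sum>i\<leftarrow>is. \<alpha> i)) (foldr (\<lambda>i. partial_deriv i ^^ \<alpha> i) is F)" for "is"
  proof (induction "is")
    case (Cons i "is")
    from iter[OF this, of "\<alpha> i" i] show ?case by (simp add: algebra_simps)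
  qed (use assms in simp)
  moreover have "distinct (coords :: 'n list) \<and> set (coords :: 'n list) = UNIV"
  proof -
    have "\<exists>is :: 'n list. distinct is \<and> set is = UNIV"
      using finite_distinct_list[OF finite_class.finite_UNIV] by blast
    then show ?thesis unfolding coords_def by (rule someI_ex)
  qed
  then have "(\<Sum>i\<leftarrow>coords. \<alpha> i) = multi_order \<alpha>"
    by (simp add: multi_order_def sum_list_distinct_conv_sum_set)
  ultimately show ?thesis
    unfolding multi_deriv_def by metis
qed

text \<open>
  There are finitely many multi-indices of a given order, so the constants of the individual
  derivatives can be combined into one that depends on the order alone.
\<close>
lemma multi_deriv_class_bound:
  fixes F :: "real ^ 'n::finite \<Rightarrow> real"
  assumes closed: "\<And>p F i. P p F \<Longrightarrow> P (p - 1) (partial_deriv i F)"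
    and bound: "\<And>G :: real ^ 'n \<Rightarrow> real. P (p - real m) G \<Longrightarrow>
      \<exists>C\<ge>0. \<forall>x. x \<noteq> 0 \<longrightarrow> norm x < r \<longrightarrow> \<bar>G x\<bar> \<le> C * norm x powr (p - real m)"
    and F: "P p F"
  shows "\<exists>\<kappa>>0. \<forall>\<alpha> :: 'n \<Rightarrow> nat. multi_order \<alpha> = m \<longrightarrow> (\<forall>x. x \<in> ball 0 r - {0} \<longrightarrow>
    \<bar>multi_deriv \<alpha> F x\<bar> \<le> \<kappa> * norm x powr (p - real (multi_order \<alpha>)))"
proof -
  let ?S = "{\<alpha> :: 'n \<Rightarrow> nat. multi_order \<alpha> = m}"
  have "?S \<subseteq> (UNIV \<rightarrow>\<^sub>E {..m})"
    by (auto simp: multi_order_def intro!: member_le_sum)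
  then have fin: "finite ?S"
    by (rule finite_subset) (intro finite_PiE finite_atMost finite)
  have "\<exists>C\<ge>0. \<forall>x. x \<noteq> 0 \<longrightarrow> norm x < r \<longrightarrow> \<bar>multi_deriv \<alpha> F x\<bar> \<le> C * norm x powr (p - real m)"
    if "multi_order \<alpha> = m" for \<alpha> :: "'n \<Rightarrow> nat"
    using bound multi_deriv_class[OF closed F, of \<alpha>] that by simp
  then obtain C :: "('n \<Rightarrow> nat) \<Rightarrow> real" where C: "\<And>\<alpha>. multi_order \<alpha> = m \<Longrightarrow> C \<alpha> \<ge> 0"
    "\<And>\<alpha> x. multi_order \<alpha> = m \<Longrightarrow> x \<noteq> 0 \<Longrightarrow> norm x < r \<Longrightarrow> \<bar>multi_deriv \<alpha> F x\<bar> \<le> C \<alpha> * norm x powr (p - real m)"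
    by metis
  have sum: "C \<alpha> \<le> 1 + sum C ?S" if "multi_order \<alpha> = m" for \<alpha>
    using member_le_sum[of \<alpha> ?S C] C(1) fin that by auto
  have "\<bar>multi_deriv \<alpha> F x\<bar> \<le> (1 + sum C ?S) * norm x powr (p - real (multi_order \<alpha>))"
    if "multi_order \<alpha> = m" "x \<in> ball 0 r - {0}" for \<alpha> x
  proof -
    have "C \<alpha> * norm x powr (p - real m) \<le> (1 + sum C ?S) * norm x powr (p - real m)"
      using sum[OF that(1)] by (intro mult_right_mono) auto
    then show ?thesis
      using C(2)[OF that(1), of x] that by (auto simp: dist_norm intro: order_trans)
  qed
  moreover have "1 + sum C ?S > 0"
    using C(1) sum_nonneg[of ?S C] by (simp add: add_pos_nonneg)
  ultimately show ?thesis by blast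
qed

section \<open>One-sided limits at the origin\<close>

lemma t_ln_t_tendsto_0: "((\<lambda>t :: real. t * ln t) \<longlongrightarrow> 0) (at_right 0)"
proof -
  have "((\<lambda>t :: real. - (ln (inverse t) / inverse t)) \<longlongrightarrow> - 0) (at_right 0)"
    by (intro tendsto_minus filterlim_compose[OF ln_x_over_x_tendsto_0 filterlim_inverse_at_top_right])
  moreover have "\<forall>\<^sub>F t :: real in at_right 0. - (ln (inverse t) / inverse t) = t * ln t"
    using eventually_at_right_less by eventually_elim (simp add: ln_inverse divide_inverse)
  ultimately show ?thesis
    by (simp add: filterlim_cong)
qed

text \<open>
  A version of Rolle's theorem for functions that have a limit but no prescribed value at the left end
  point, as is the case for expressions containing \<open>ln t\<close>.
\<close>
lemma Rolle_at_right_0: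
  fixes f f' :: "real \<Rightarrow> real"
  assumes "b > 0" "(f \<longlongrightarrow> 0) (at_right 0)" "f b = 0"
    and f': "\<And>t. 0 < t \<Longrightarrow> t \<le> b \<Longrightarrow> (f has_real_derivative f' t) (at t)"
  obtains t where "0 < t" "t < b" "f' t = 0"
proof -
  \<comment> \<open>Give the limit as value at the end point and apply the classical theorem.\<close>
  define g where "g t = (if t \<le> 0 then 0 else f t)" for t
  have g': "(g has_real_derivative f' t) (at t)" if "0 < t" "t \<le> b" for t
    using f'[OF that]
    by (rule has_field_derivative_transform_within_open[where S = "{0<..}"]) (use that in \<open>auto simp: g_def\<close>)
  have "(g \<longlongrightarrow> g 0) (at_right 0)"
  proof (rule Lim_transform_eventually[OF _ ])
    show "(f \<longlongrightarrow> g 0) (at_right 0)" using assms(2) by (simp add: g_def)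
    show "\<forall>\<^sub>F t in at_right 0. f t = g t"
      using eventually_at_right_less by eventually_elim (simp add: g_def)
  qed
  moreover have cont: "isCont g t" if "0 < t" "t \<le> b" for t
    using g'[OF that] by (rule DERIV_isCont)
  moreover have "(g \<longlongrightarrow> g b) (at_left b)"
    using cont[of b] assms(1) by (auto simp: isCont_def intro: filterlim_mono at_le)
  ultimately have "continuous_on {0..b} g"
    using assms(1) by (intro continuous_on_IccI) (auto simp: isCont_def)
  moreover have "g 0 = g b" using assms(3) by (simp add: g_def)
  ultimately obtain z where "0 < z" "z < b" "f' z = 0"
    using Rolle_deriv[of 0 b g "\<lambda>t. (*) (f' t)"] g' assms(1)
    by (auto simp: has_field_derivative_def fun_eq_iff)
  then show thesis by (rule that)
qed

text \<open>
  By the intermediate value theorem a continuous function without zeros keeps the positive sign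
  that its limit gives it near the left end point; compactness does the rest.
\<close>
lemma bounds_from_limit_at_right_0:
  fixes q :: "real \<Rightarrow> real"
  assumes "r > 0" and cont: "continuous_on {0<..r} q" and nz: "\<And>t. t \<in> {0<..r} \<Longrightarrow> q t \<noteq> 0"
    and lim: "(q \<longlongrightarrow> L) (at_right 0)" and "L > 0"
  obtains a b where "a > 0" "b > 0" "\<And>t. t \<in> {0<..r} \<Longrightarrow> a \<le> q t \<and> q t \<le> b"
proof -
  have "\<forall>\<^sub>F t in at_right 0. L / 2 < q t \<and> q t < 2 * L"
    using order_tendstoD(1)[OF lim, of "L / 2"] order_tendstoD(2)[OF lim, of "2 * L"] \<open>L > 0\<close>
    by (intro eventually_conj) simp_all
  then obtain d where d: "d > 0" "\<And>t. 0 < t \<Longrightarrow> t < d \<Longrightarrow> L / 2 < q t \<and> q t < 2 * L"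
    unfolding eventually_at_right_field by auto
  \<comment> \<open>The limit controls \<open>q\<close> up to \<open>d\<close>; beyond \<open>e < d\<close> the interval is compact.\<close>
  define e where "e = min (d / 2) r"
  have e: "0 < e" "e < d" "e \<le> r" using d \<open>r > 0\<close> by (auto simp: e_def)
  have cont': "continuous_on {e..r} q"
    using e by (intro continuous_on_subset[OF cont]) auto
  have pos: "q t > 0" if t: "t \<in> {e..r}" for t
  proof (rule ccontr)
    assume "\<not> q t > 0"
    moreover have "q e > 0" using d(2)[of e] e \<open>L > 0\<close> by auto
    moreover have "continuous_on {e..t} q" using t by (intro continuous_on_subset[OF cont']) auto
    ultimately obtain s where "e \<le> s" "s \<le> t" "q s = 0"
      using IVT2'[of q t 0 e] t by auto
    then show False using nz[of s] e t by auto
  qed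
  obtain m where m: "m \<in> {e..r}" "\<And>t. t \<in> {e..r} \<Longrightarrow> q m \<le> q t"
    using continuous_attains_inf[OF _ _ cont'] e by auto
  obtain M where M: "M \<in> {e..r}" "\<And>t. t \<in> {e..r} \<Longrightarrow> q t \<le> q M"
    using continuous_attains_sup[OF _ _ cont'] e by auto
  show thesis
  proof (rule that[of "min (L / 2) (q m)" "max (2 * L) (q M)"])
    show "min (L / 2) (q m) > 0" "max (2 * L) (q M) > 0" using pos[OF m(1)] \<open>L > 0\<close> by auto
    show "min (L / 2) (q m) \<le> q t \<and> q t \<le> max (2 * L) (q M)" if "t \<in> {0<..r}" for t
    proof (cases "t < d")
      case True
      then show ?thesis using d(2)[of t] that by auto
    next
      case False
      then show ?thesis using m(2)[of t] M(2)[of t] that e by auto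
    qed
  qed
qed

lemma eval_fps_square_tendsto:
  fixes F :: "real fps"
  assumes "entire_fps F"
  shows "((\<lambda>t. eval_fps F (t\<^sup>2)) \<longlongrightarrow> fps_nth F 0) (at_right 0)"
proof -
  have "isCont (\<lambda>t. eval_fps F (t\<^sup>2)) 0"
    using DERIV_eval_fps_square[OF assms] by (rule DERIV_isCont)
  then have "((\<lambda>t. eval_fps F (t\<^sup>2)) \<longlongrightarrow> fps_nth F 0) (at 0)"
    by (simp add: isCont_def eval_fps_at_0)
  then show ?thesis
    by (rule filterlim_mono) (auto intro: at_le)
qed

lemma weighted_Y_tendsto:
  assumes "j > 0"
  shows "(weighted_Y (real j / 2) \<longlongrightarrow> - (2 powr (real j / 2) * Gamma (real j / 2) / pi)) (at_right 0)"
proof -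
  obtain A B :: "real fps" where AB: "entire_fps A" "entire_fps B"
    "fps_nth A 0 = - (2 powr (real j / 2) * Gamma (real j / 2) / pi)"
    "\<And>t. t > 0 \<Longrightarrow> weighted_Y (real j / 2) t = eval_fps A (t\<^sup>2) + t ^ j * ln t * eval_fps B (t\<^sup>2)"
    using weighted_Y_expansion[of j] assms by metis
  have "((\<lambda>t :: real. t ^ (j - 1) * (t * ln t)) \<longlongrightarrow> 0 ^ (j - 1) * 0) (at_right 0)"
    by (intro tendsto_intros t_ln_t_tendsto_0)
  moreover have "t ^ (j - 1) * (t * ln t) = t ^ j * ln t" for t :: real
    using assms by (cases j) (auto simp: mult_ac)
  ultimately have "((\<lambda>t :: real. t ^ j * ln t) \<longlongrightarrow> 0) (at_right 0)" by (simp only: mult_zero_right)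
  then have "((\<lambda>t. eval_fps A (t\<^sup>2) + t ^ j * ln t * eval_fps B (t\<^sup>2)) \<longlongrightarrow>
      fps_nth A 0 + 0 * fps_nth B 0) (at_right 0)"
    by (intro tendsto_intros eval_fps_square_tendsto AB)
  moreover have "\<forall>\<^sub>F t in at_right 0. eval_fps A (t\<^sup>2) + t ^ j * ln t * eval_fps B (t\<^sup>2) = weighted_Y (real j / 2) t"
    using eventually_at_right_less by eventually_elim (simp add: AB(4))
  ultimately have "(weighted_Y (real j / 2) \<longlongrightarrow> fps_nth A 0 + 0 * fps_nth B 0) (at_right 0)"
    by (rule Lim_transform_eventually)
  then show ?thesis
    by (simp add: AB(3))
qed

lemma inverse_ln_tendsto_0: "((\<lambda>t :: real. inverse (ln t)) \<longlongrightarrow> 0) (at_right 0)"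
  by (rule filterlim_compose[OF tendsto_inverse_0 filterlim_mono[OF ln_at_0 at_bot_le_at_infinity order_refl]])

lemma weighted_Y_0_over_ln_tendsto: "((\<lambda>t. weighted_Y 0 t / ln t) \<longlongrightarrow> 2 / pi) (at_right 0)"
proof -
  obtain A B :: "real fps" where AB: "entire_fps A" "entire_fps B" "fps_nth B 0 = 2 / pi"
    "\<And>t. t > 0 \<Longrightarrow> weighted_Y 0 t = eval_fps A (t\<^sup>2) + ln t * eval_fps B (t\<^sup>2)"
    using weighted_Y_expansion[of 0] by auto
  have "((\<lambda>t. eval_fps A (t\<^sup>2) * inverse (ln t) + eval_fps B (t\<^sup>2)) \<longlongrightarrow> fps_nth A 0 * 0 + fps_nth B 0) (at_right 0)"
    by (intro tendsto_intros eval_fps_square_tendsto AB inverse_ln_tendsto_0)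
  moreover have "\<forall>\<^sub>F t :: real in at_right 0. 0 < t \<and> t < 1"
    by (auto simp: eventually_at_right_field intro: exI[of _ 1])
  then have "\<forall>\<^sub>F t in at_right 0. eval_fps A (t\<^sup>2) * inverse (ln t) + eval_fps B (t\<^sup>2) = weighted_Y 0 t / ln t"
    by eventually_elim (simp add: AB(4) field_simps)
  ultimately show ?thesis
    using Lim_transform_eventually by (fastforce simp: AB(3))
qed

section \<open>Special values and the first zero of order zero\<close>

lemma isCont_weighted_Y:
  assumes "t > 0"
  shows "isCont (weighted_Y (real j / 2)) t"
proof -
  obtain A B :: "real fps" where AB: "entire_fps A" "entire_fps B"
    "\<And>t. t > 0 \<Longrightarrow> weighted_Y (real j / 2) t = eval_fps A (t\<^sup>2) + t ^ j * ln t * eval_fps B (t\<^sup>2)"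
    using weighted_Y_expansion[of j] by metis
  have "isCont (\<lambda>t. eval_fps A (t\<^sup>2) + t ^ j * ln t * eval_fps B (t\<^sup>2)) t"
    using assms DERIV_isCont[OF DERIV_eval_fps_square[OF AB(1)]] DERIV_isCont[OF DERIV_eval_fps_square[OF AB(2)]]
    by (intro continuous_intros) auto
  moreover have "\<forall>\<^sub>F t in nhds t. weighted_Y (real j / 2) t = eval_fps A (t\<^sup>2) + t ^ j * ln t * eval_fps B (t\<^sup>2)"
    using eventually_nhds_in_open[of "{0<..}" t] assms by (auto elim!: eventually_mono simp: AB(3))
  ultimately show ?thesis
    by (simp add: isCont_cong)
qed

text \<open>
  With \<open>H\<^sub>k\<close> the harmonic numbers and \<open>\<gamma>\<close> Euler's constant,
  \<open>\<pi>/2 Y\<^sub>0(1) = - \<Sum>\<^sub>k (-1)\<^sup>k (H\<^sub>k + ln 2 - \<gamma>) / (k!\<^sup>2 4\<^sup>k)\<close>. The term for \<open>k = 0\<close> is small, the one for \<open>k = 1\<close> is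
  large, and from there on the terms decrease, so the alternating series test applies to the tail.
\<close>
lemma bessel_Y_0_at_1_pos: "bessel_Y 0 1 > 0"
proof -
  define \<delta> :: real where "\<delta> = ln 2 - euler_mascheroni"
  have \<delta>: "0 < \<delta>" "\<delta> < 1/5"
    using ln2_ge_two_thirds ln2_le_25_over_36 euler_mascheroni_gt_19_over_33 euler_mascheroni_less_13_over_22
    unfolding \<delta>_def by linarith+
  define a where "a k = (harm k + \<delta>) / (fact k ^ 2 * 4 ^ k)" for k
  have coeff: "fps_nth (bessel_fps' 0 - fps_const (ln 2) * bessel_fps 0) k = - ((-1) ^ k * a k)" for k
  proof -
    have "real k + 1 \<notin> \<int>\<^sub>\<le>\<^sub>0"
      by (auto elim!: nonpos_Ints_cases)
    then have "deriv rGamma (real k + 1) = - rGamma (real k + 1) * Digamma (real k + 1)"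
      by (intro DERIV_imp_deriv has_field_derivative_rGamma_no_nonpos_int)
    also have "\<dots> = - (1 / fact k) * (harm k - euler_mascheroni)"
      using Digamma_of_nat[of k, where ?'a = real] rGamma_Suc_nat[of k] by (simp add: add_ac)
    finally have d: "deriv rGamma (real k + 1) - ln 2 * rGamma (real k + 1) = - ((harm k + \<delta>) / fact k)"
      unfolding rGamma_Suc_nat \<delta>_def by (simp add: field_simps)
    have "fps_nth (bessel_fps' 0 - fps_const (ln 2) * bessel_fps 0) k =
        (-1) ^ k * (deriv rGamma (real k + 1) - ln 2 * rGamma (real k + 1)) / (fact k * 4 ^ k)"
      by (simp add: bessel_fps'_def bessel_fps_def diff_divide_distrib right_diff_distrib)
    then show ?thesis
      unfolding d by (simp add: a_def power2_eq_square)
  qed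
  have ent: "entire_fps (bessel_fps' 0 - fps_const (ln 2) * bessel_fps 0)"
    using fps_conv_radius_diff[of "bessel_fps' 0" "fps_const (ln 2) * bessel_fps 0"]
    by (simp add: entire_fps_cmult entire_bessel_fps)
  have "bessel_Y 0 1 = weighted_Y (real 0) 1"
    by (simp add: weighted_Y_def)
  also have "\<dots> = 2 / pi * (eval_fps (bessel_fps' 0) 1 - ln 2 * eval_fps (bessel_fps 0) 1)"
    by (subst weighted_Y_nat) (simp_all add: ln_div field_simps)
  also have "eval_fps (bessel_fps' 0) 1 - ln 2 * eval_fps (bessel_fps 0) 1 =
     eval_fps (bessel_fps' 0 - fps_const (ln 2) * bessel_fps 0) 1"
    by (simp add: eval_fps_diff eval_fps_cmult entire_fps_cmult entire_bessel_fps)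
  finally have Y: "bessel_Y 0 1 = 2 / pi * eval_fps (bessel_fps' 0 - fps_const (ln 2) * bessel_fps 0) 1" .
  have "(\<lambda>k. - ((-1) ^ k * a k)) sums eval_fps (bessel_fps' 0 - fps_const (ln 2) * bessel_fps 0) 1"
    using sums_eval_fps[of 1 "bessel_fps' 0 - fps_const (ln 2) * bessel_fps 0"] ent unfolding coeff by simp
  then have sums: "(\<lambda>k. (-1) ^ k * a (Suc k)) sums
      (eval_fps (bessel_fps' 0 - fps_const (ln 2) * bessel_fps 0) 1 + a 0)"
    using sums_Suc_iff[of "\<lambda>k. - ((-1) ^ k * a k)" "eval_fps (bessel_fps' 0 - fps_const (ln 2) * bessel_fps 0) 1 + a 0"]
    by simp
  have "a (Suc 0) - a (Suc 1) \<le> (\<Sum>k. (-1) ^ k * a (Suc k))"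
  proof -
    have "(\<lambda>k. norm ((-1) ^ k * a (Suc k))) \<longlonglongrightarrow> 0"
      using sums by (intro tendsto_norm_zero summable_LIMSEQ_zero) (auto simp: sums_iff)
    then have "(\<lambda>k. a (Suc k)) \<longlonglongrightarrow> 0"
      by (simp add: abs_mult tendsto_rabs_zero_iff)
    moreover have "0 \<le> a (Suc k)" for k
      unfolding a_def using \<delta> harm_nonneg[of "Suc k", where ?'a = real] by simp
    moreover have "a (Suc (Suc k)) \<le> a (Suc k)" for k
    proof -
      have h: "harm (Suc k) \<ge> (1 :: real)"
        by (induction k) (auto simp: harm_Suc harm_def intro: order_trans)
      have "harm (Suc (Suc k)) \<le> harm (Suc k) + (1 :: real)"
        unfolding harm_Suc[of "Suc k"] by (simp add: field_simps)
      then have "harm (Suc (Suc k)) + \<delta> \<le> 4 * (harm (Suc k) + \<delta>)"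
        using h \<delta> unfolding distrib_left by linarith
      then have "a (Suc (Suc k)) \<le> (4 * (harm (Suc k) + \<delta>)) / (fact (Suc (Suc k)) ^ 2 * 4 ^ Suc (Suc k))"
        unfolding a_def by (intro divide_right_mono) auto
      also have "\<dots> = a (Suc k) / (real (Suc (Suc k)))\<^sup>2"
        unfolding a_def fact_Suc[of "Suc k"] by (simp add: power_mult_distrib field_simps del: fact_Suc of_nat_Suc)
      also have "\<dots> \<le> a (Suc k) / 1"
        using h \<delta> by (intro divide_left_mono) (auto simp: a_def)
      finally show ?thesis by simp
    qed
    ultimately show ?thesis
      using summable_Leibniz'(2)[of "\<lambda>k. a (Suc k)" 1] by (simp add: numeral_2_eq_2)
  qed
  then have "a (Suc 0) - a (Suc 1) \<le> eval_fps (bessel_fps' 0 - fps_const (ln 2) * bessel_fps 0) 1 + a 0"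
    by (simp only: sums_unique[OF sums, symmetric])
  moreover have "a 0 = \<delta>" "a (Suc 0) = (1 + \<delta>) / 4" "a (Suc 1) = (3/2 + \<delta>) / 64"
    by (simp_all add: a_def harm_def numeral_2_eq_2)
  ultimately have "eval_fps (bessel_fps' 0 - fps_const (ln 2) * bessel_fps 0) 1 > 0"
    using \<delta> unfolding add_divide_distrib by linarith
  then show ?thesis
    unfolding Y by simp
qed

lemma bessel_Y_first_zero_le:
  assumes "0 < t" "bessel_Y \<nu> t = 0"
  shows "bessel_Y_first_zero \<nu> \<le> t"
  unfolding bessel_Y_first_zero_def
  by (rule cInf_lower) (use assms in \<open>auto intro!: bdd_belowI[of _ 0]\<close>)

text \<open>
  Since \<open>Y\<^sub>0\<close> tends to \<open>-\<infinity>\<close> at the origin and is positive at \<open>1\<close>, it has a zero in between. In dimension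
  four this forces \<open>r < 1\<close> and keeps \<open>ln |x|\<close> away from zero on the ball.
\<close>
lemma bessel_Y_first_zero_0_le_1: "bessel_Y_first_zero 0 \<le> 1"
proof -
  have "\<forall>\<^sub>F t in at_right 0. 0 < weighted_Y 0 t / ln t"
    using weighted_Y_0_over_ln_tendsto by (rule order_tendstoD) simp
  then obtain d where d: "d > 0" "\<And>t. 0 < t \<Longrightarrow> t < d \<Longrightarrow> 0 < weighted_Y 0 t / ln t"
    unfolding eventually_at_right_field by auto
  \<comment> \<open>Close to the origin \<open>Y\<^sub>0 / ln\<close> is positive, so \<open>Y\<^sub>0\<close> is negative.\<close>
  define s where "s = min (d / 2) (1 / 2)"
  have s: "0 < s" "s < d" "s < 1" using d(1) by (auto simp: s_def)
  have "weighted_Y 0 s < 0"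
    using d(2)[OF s(1,2)] s by (simp add: zero_less_divide_iff ln_less_zero_iff)
  moreover have "weighted_Y 0 1 > 0"
    using bessel_Y_0_at_1_pos by (simp add: weighted_Y_def)
  moreover have "continuous_on {s..1} (weighted_Y 0)"
    using isCont_weighted_Y[of _ 0] s by (intro continuous_at_imp_continuous_on) auto
  ultimately obtain t where "s \<le> t" "t \<le> 1" "weighted_Y 0 t = 0"
    using IVT'[of "weighted_Y 0" s 0 1] s by auto
  then show ?thesis
    using bessel_Y_first_zero_le[of t 0] s by (auto simp: weighted_Y_def)
qed

text \<open>
  In dimension three everything is elementary: the duplication of factorials turns the series of
  order \<open>-1/2\<close> into that of the cosine.
\<close>
lemma weighted_Y_one_half:
  assumes "t > 0"
  shows "weighted_Y (1/2) t = - (2 powr (1/2) * Gamma (1/2) / pi) * cos t"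
proof -
  have rg: "rGamma (real k + 1/2) / (fact k * 4 ^ k) = rGamma (1/2) / fact (2 * k)" for k
  proof (induction k)
    case (Suc k)
    have "rGamma (real k + 1/2) = (real k + 1/2) * rGamma (real (Suc k) + 1/2)"
      using rGamma_plus1[of "real k + 1/2"] by (simp add: add_ac)
    then have "rGamma (real (Suc k) + 1/2) / (fact (Suc k) * 4 ^ Suc k) =
       rGamma (real k + 1/2) / (fact k * 4 ^ k) / ((real k + 1/2) * (real k + 1) * 4)"
    proof -
      assume eq: "rGamma (real k + 1/2) = (real k + 1/2) * rGamma (real (Suc k) + 1/2)"
      have *: "x * g / D / (x * y * 4) = g / (D * (y * 4))" if "x \<noteq> 0" for x y g D :: real
        using that by simp
      have "real k + 1/2 \<noteq> 0" by (simp add: add_nonneg_eq_0_iff)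
      then show ?thesis
        unfolding eq by (subst *) (simp_all add: algebra_simps)
    qed
    also have "\<dots> = rGamma (1/2) / (fact (2 * k) * ((real k + 1/2) * (real k + 1) * 4))"
      unfolding Suc by simp
    also have "fact (2 * k) * ((real k + 1/2) * (real k + 1) * 4) = fact (2 * Suc k)"
      by (simp add: algebra_simps)
    finally show ?case .
  qed simp
  have "fps_nth (bessel_fps (- (1/2))) k * (t\<^sup>2) ^ k = rGamma (1/2) * ((-1) ^ k / fact (2 * k) * t ^ (2 * k))" for k
  proof -
    have "real k + - (1/2) + 1 = real k + 1/2" by simp
    then have "fps_nth (bessel_fps (- (1/2))) k = (-1) ^ k * (rGamma (real k + 1/2) / (fact k * 4 ^ k))"
      by (simp only: bessel_fps_def fps_nth_Abs_fps times_divide_eq_right)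
    then show ?thesis unfolding rg by (simp add: power_mult)
  qed
  then have "eval_fps (bessel_fps (- (1/2))) (t\<^sup>2) = rGamma (1/2) * cos t"
    unfolding eval_fps_def using sums_mult[OF cos_paired[of t], of "rGamma (1/2)"] by (simp add: sums_iff)
  moreover have "rGamma (1/2) = Gamma (1/2) / pi"
    using rGamma_half_odd[of 0] by simp
  ultimately show ?thesis
    using weighted_Y_half_odd[OF assms, of 0] by simp
qed

section \<open>The difference of the fundamental solutions\<close>

lemma fps_split_constant: "F = fps_const (fps_nth F 0) + fps_X * fps_shift 1 (F :: real fps)"
proof (rule fps_ext)
  show "fps_nth F n = fps_nth (fps_const (fps_nth F 0) + fps_X * fps_shift 1 F) n" for n
    by (cases n) simp_all
qed

text \<open>
  With \<open>\<nu> = (N - 2) / 2\<close> this says that the constant of Laplace's fundamental solution is the leading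
  coefficient of \<open>\<Psi>\<close> at the origin.
\<close>
lemma Lambda_constant:
  assumes "\<nu> > 0"
  shows "1 / ((2 * \<nu> + 2) * (2 * \<nu>) * unit_ball_vol (2 * \<nu> + 2)) =
    1 / 4 * (2 * pi) powr (- \<nu>) * (2 powr \<nu> * Gamma \<nu> / pi)"
proof -
  have "Gamma (\<nu> + 1) = \<nu> * Gamma \<nu>"
    using assms by (intro Gamma_plus1) (auto elim!: nonpos_Ints_cases)
  moreover have "Gamma (\<nu> + 1 + 1) = (\<nu> + 1) * Gamma (\<nu> + 1)"
    using assms by (intro Gamma_plus1) (auto elim!: nonpos_Ints_cases)
  moreover have "(2 * \<nu> + 2) / 2 = \<nu> + 1" by simp
  ultimately have vol: "unit_ball_vol (2 * \<nu> + 2) = pi powr (\<nu> + 1) / ((\<nu> + 1) * (\<nu> * Gamma \<nu>))"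
    unfolding unit_ball_vol_def by (simp only:)
  have "(2 * pi) powr (- \<nu>) * 2 powr \<nu> * pi powr \<nu> = 1"
    by (simp add: powr_mult powr_minus field_simps)
  moreover have "pi powr (\<nu> + 1) = pi powr \<nu> * pi" by (simp add: powr_add)
  moreover have "Gamma \<nu> > 0" using assms by (rule Gamma_real_pos)
  ultimately show ?thesis
    unfolding vol using assms by (simp add: divide_simps)
qed

text \<open>
  For \<open>\<nu> > 0\<close> the limit of \<^term>\<open>weighted_Y \<nu>\<close> at the origin, minus the function itself. In dimension
  \<open>2 \<nu> + 2\<close> it is the radial profile of \<open>\<Psi> - \<Lambda>\<close> up to a positive constant and the weight
  \<open>|x|\<^sup>-\<^sup>2\<^sup>\<nu>\<close>.
\<close>
definition excess :: "real \<Rightarrow> real \<Rightarrow> real" where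
  "excess \<nu> t = - (2 powr \<nu> * Gamma \<nu> / pi) - weighted_Y \<nu> t"

lemma Psi_minus_Lambda:
  fixes x :: "real ^ 'n::finite"
  assumes "CARD('n) = j + 2" "j > 0" "x \<noteq> 0"
  shows "Psi x - Lambda x = 1 / 4 * (2 * pi) powr (- (real j / 2)) *
    (norm x powr (2 - real CARD('n)) * excess (real j / 2) (norm x))"
proof -
  define \<nu> where "\<nu> = real j / 2"
  have \<nu>: "\<nu> > 0" using assms(2) by (simp add: \<nu>_def)
  define c where "c = 1 / 4 * (2 * pi) powr (- \<nu>)"
  have N: "real CARD('n) = 2 * \<nu> + 2" by (simp add: assms(1) \<nu>_def)
  have nx: "norm x > 0" using assms(3) by simp
  have "Psi x = - c * (norm x powr (- \<nu>) * bessel_Y \<nu> (norm x))"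
    using nx unfolding Psi_def N c_def by (simp add: powr_mult)
  also have "norm x powr (- \<nu>) * bessel_Y \<nu> (norm x) = norm x powr (2 - real CARD('n)) * weighted_Y \<nu> (norm x)"
    unfolding weighted_Y_def N by (simp flip: powr_add mult.assoc)
  finally have Psi: "Psi x = - c * (norm x powr (2 - real CARD('n)) * weighted_Y \<nu> (norm x))" .
  have "Lambda x = c * (2 powr \<nu> * Gamma \<nu> / pi) * norm x powr (2 - real CARD('n))"
    unfolding Lambda_def c_def Lambda_constant[OF \<nu>, symmetric] N by simp
  with Psi show ?thesis
    unfolding \<nu>_def[symmetric] c_def[symmetric] excess_def by (simp add: algebra_simps)
qed

text \<open>
  Subtracting \<open>\<Lambda>\<close> removes the constant term of \<open>A\<close> in the expansion, and the weight \<open>|x|\<^sup>2\<^sup>-\<^sup>N\<close> cancels the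
  power in front of the logarithm. What is left is
  \<open>|x|\<^sup>4\<^sup>-\<^sup>N H(|x|\<^sup>2) + G(|x|\<^sup>2) ln |x|\<close> with entire \<open>H\<close> and \<open>G\<close>, where \<open>G = 0\<close> in odd dimensions.
\<close>
lemma Psi_minus_Lambda_class:
  fixes f :: "real ^ 'n::finite \<Rightarrow> real"
  assumes "CARD('n) \<ge> 3"
  defines "f \<equiv> \<lambda>x. Psi x - Lambda x"
  shows "if CARD('n) = 3 then singular_class (4 - real CARD('n)) f
         else log_singular_class (4 - real CARD('n)) f"
proof -
  define j where "j = CARD('n) - 2"
  have j: "CARD('n) = j + 2" "j > 0" using assms(1) by (auto simp: j_def)
  define c where "c = 1 / 4 * (2 * pi) powr (- (real j / 2))"
  obtain A B :: "real fps" where AB: "entire_fps A" "entire_fps B" "odd j \<Longrightarrow> B = 0"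
    "fps_nth A 0 = - (2 powr (real j / 2) * Gamma (real j / 2) / pi)"
    "\<And>t. t > 0 \<Longrightarrow> weighted_Y (real j / 2) t = eval_fps A (t\<^sup>2) + t ^ j * ln t * eval_fps B (t\<^sup>2)"
    using weighted_Y_expansion[of j] j(2) by metis
  define H where "H = fps_const (- c) * fps_shift 1 A"
  have A1: "entire_fps (fps_shift 1 A)" using AB(1) by simp
  then have H: "entire_fps H" unfolding H_def by (rule entire_fps_cmult)
  have xA1: "entire_fps (fps_X * fps_shift 1 A)"
    using fps_conv_radius_mult[of fps_X "fps_shift 1 A"] A1 by simp
  have eA: "eval_fps A s = fps_nth A 0 + s * eval_fps (fps_shift 1 A) s" for s
    by (subst fps_split_constant[of A]) (simp add: eval_fps_add eval_fps_mult AB(1) xA1 del: One_nat_def)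
  define h where "h = (\<lambda>x :: real ^ 'n. norm x powr (4 - real CARD('n)) * eval_fps H ((norm x)\<^sup>2))"
  have h: "singular_class (4 - real CARD('n)) h"
    unfolding h_def by (rule singular_class.radial[OF H])
  define g where "g = (\<lambda>x :: real ^ 'n. eval_fps (fps_const (- c) * B) ((norm x)\<^sup>2))"
  have g: "regular_class g"
    unfolding g_def by (intro regular_class.radial entire_fps_cmult AB)
  have f: "f x = g x * ln (norm x) + h x" if "x \<noteq> 0" for x
  proof -
    define t where "t = norm x"
    have t: "t > 0" using that by (simp add: t_def)
    have p: "t powr (4 - real CARD('n)) = t powr (2 - real CARD('n)) * t\<^sup>2"
      using t powr_add[of t "2 - real CARD('n)" 2] by (simp add: powr_numeral)
    have "t powr (2 - real CARD('n)) * t powr real j = 1"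
      using t by (simp add: j(1) flip: powr_add)
    then have q: "t powr (2 - real CARD('n)) * t ^ j = 1"
      using t by (simp add: powr_realpow)
    have "excess (real j / 2) t = - (t\<^sup>2 * eval_fps (fps_shift 1 A) (t\<^sup>2)) - t ^ j * ln t * eval_fps B (t\<^sup>2)"
      using t unfolding excess_def AB(4)[symmetric] by (simp add: AB(5) eA del: One_nat_def)
    then have "f x = c * (t powr (2 - real CARD('n)) * (- (t\<^sup>2 * eval_fps (fps_shift 1 A) (t\<^sup>2)) - t ^ j * ln t * eval_fps B (t\<^sup>2)))"
      unfolding f_def Psi_minus_Lambda[OF j that] c_def t_def by simp
    also have "\<dots> = - c * (t powr (2 - real CARD('n)) * t\<^sup>2 * eval_fps (fps_shift 1 A) (t\<^sup>2))
       - c * ((t powr (2 - real CARD('n)) * t ^ j) * ln t * eval_fps B (t\<^sup>2))"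
      by (simp add: algebra_simps)
    also have "\<dots> = g x * ln (norm x) + h x"
      unfolding q p[symmetric] g_def h_def t_def[symmetric] H_def eval_fps_cmult[OF A1] eval_fps_cmult[OF AB(2)]
      by (simp add: algebra_simps)
    finally show ?thesis .
  qed
  show ?thesis
  proof (cases "CARD('n) = 3")
    case True
    then have "B = 0" using AB(3) j by simp
    then have "singular_class (4 - real CARD('n)) f"
      by (intro singular_class.cong[OF h]) (simp add: f g_def)
    then show ?thesis using True by simp
  next
    case False
    then have "4 - real CARD('n) \<le> 0" using assms(1) by simp
    then have "log_singular_class (4 - real CARD('n)) f"
      unfolding log_singular_class_def using g h f by blast
    then show ?thesis using False by simp
  qed
qed

lemma DERIV_excess:
  assumes "t > 0"
  shows "(excess (real (j + 2) / 2) has_real_derivative - (t * weighted_Y (real j / 2) t)) (at t)"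
  unfolding excess_def using DERIV_diff[OF DERIV_const DERIV_weighted_Y[OF assms, of j]] by simp

lemma excess_tendsto_0:
  assumes "j > 0"
  shows "(excess (real j / 2) \<longlongrightarrow> 0) (at_right 0)"
  unfolding excess_def
  using tendsto_diff[OF tendsto_const[of "- (2 powr (real j / 2) * Gamma (real j / 2) / pi)"] weighted_Y_tendsto[OF assms]] by simp

text \<open>
  The excess tends to zero at the origin and its derivative is \<open>- t\<close> times the weighted Bessel function
  one order below, which has no zero up to \<open>r\<close>. By Rolle's theorem the excess has none either.
\<close>
lemma excess_nonzero:
  assumes "\<And>t. 0 < t \<Longrightarrow> t \<le> r \<Longrightarrow> bessel_Y (real j / 2) t \<noteq> 0" "0 < t" "t \<le> r"
  shows "excess (real (j + 2) / 2) t \<noteq> 0"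
proof
  assume "excess (real (j + 2) / 2) t = 0"
  then obtain s where "0 < s" "s < t" "- (s * weighted_Y (real j / 2) s) = 0"
    using Rolle_at_right_0[of t "excess (real (j + 2) / 2)" "\<lambda>s. - (s * weighted_Y (real j / 2) s)"]
      excess_tendsto_0[of "j + 2"] DERIV_excess assms(2) by auto
  then show False
    using assms(1)[of s] assms(3) by (simp add: weighted_Y_def)
qed

lemma continuous_on_excess: "continuous_on {0<..r} (excess (real (j + 2) / 2))"
  by (intro continuous_at_imp_continuous_on ballI DERIV_isCont[OF DERIV_excess]) auto

text \<open>
  L'Hopital's rule reduces the limit at the origin to that of the weighted Bessel function one order
  below; that limit is finite and negative because the lower order is still positive.
\<close>
lemma excess_bounds:
  assumes "j > 0" "r > 0" "\<And>t. 0 < t \<Longrightarrow> t \<le> r \<Longrightarrow> bessel_Y (real j / 2) t \<noteq> 0"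
  obtains a b where "a > 0" "b > 0"
    "\<And>t. t \<in> {0<..r} \<Longrightarrow> a \<le> excess (real (j + 2) / 2) t / t\<^sup>2 \<and> excess (real (j + 2) / 2) t / t\<^sup>2 \<le> b"
proof (rule bounds_from_limit_at_right_0[of r "\<lambda>t. excess (real (j + 2) / 2) t / t\<^sup>2"])
  let ?L = "2 powr (real j / 2) * Gamma (real j / 2) / pi"
  show "?L / 2 > 0"
    using Gamma_real_pos[of "real j / 2"] assms(1) by simp
  show "continuous_on {0<..r} (\<lambda>t. excess (real (j + 2) / 2) t / t\<^sup>2)"
    by (intro continuous_intros continuous_on_excess) auto
  show "excess (real (j + 2) / 2) t / t\<^sup>2 \<noteq> 0" if "t \<in> {0<..r}" for t
    using excess_nonzero[OF assms(3), of t] that by auto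
  show "((\<lambda>t. excess (real (j + 2) / 2) t / t\<^sup>2) \<longlongrightarrow> ?L / 2) (at_right 0)"
  proof (rule lhopital_right_0[where f' = "\<lambda>t. - (t * weighted_Y (real j / 2) t)" and g' = "\<lambda>t. 2 * t"])
    show "(excess (real (j + 2) / 2) \<longlongrightarrow> 0) (at_right 0)"
      using excess_tendsto_0[of "j + 2"] by simp
    show "((\<lambda>t :: real. t\<^sup>2) \<longlongrightarrow> 0) (at_right 0)"
      by (rule tendsto_eq_intros refl)+ simp
    show "\<forall>\<^sub>F t :: real in at_right 0. t\<^sup>2 \<noteq> 0" "\<forall>\<^sub>F t :: real in at_right 0. 2 * t \<noteq> 0"
      using eventually_at_right_less by (eventually_elim, simp)+
    show "\<forall>\<^sub>F t in at_right 0. (excess (real (j + 2) / 2) has_real_derivative - (t * weighted_Y (real j / 2) t)) (at t)"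
      using eventually_at_right_less by eventually_elim (rule DERIV_excess)
    show "\<forall>\<^sub>F t in at_right 0. ((\<lambda>t :: real. t\<^sup>2) has_real_derivative 2 * t) (at t)"
      by (intro always_eventually allI) (auto intro!: derivative_eq_intros)
    have "((\<lambda>t. - (weighted_Y (real j / 2) t / 2)) \<longlongrightarrow> - (- ?L / 2)) (at_right 0)"
      using assms(1) by (intro tendsto_intros tendsto_divide[OF weighted_Y_tendsto]) auto
    moreover have "\<forall>\<^sub>F t in at_right 0. - (weighted_Y (real j / 2) t / 2) = - (t * weighted_Y (real j / 2) t) / (2 * t)"
      using eventually_at_right_less by eventually_elim simp
    ultimately show "((\<lambda>t. - (t * weighted_Y (real j / 2) t) / (2 * t)) \<longlongrightarrow> ?L / 2) (at_right 0)"
      using Lim_transform_eventually by fastforce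
  qed
qed (use assms(2) that in blast)+

text \<open>
  The case in which the order drops to zero: the derivative of the excess is \<open>- t Y\<^sub>0(t)\<close>, and
  \<open>Y\<^sub>0(t) ~ (2/\<pi>) ln t\<close>.
\<close>
lemma excess_1_bounds:
  assumes "0 < r" "r < 1" "\<And>t. 0 < t \<Longrightarrow> t \<le> r \<Longrightarrow> bessel_Y 0 t \<noteq> 0"
  obtains a b where "a > 0" "b > 0"
    "\<And>t. t \<in> {0<..r} \<Longrightarrow> a \<le> excess 1 t / (- (t\<^sup>2 * ln t)) \<and> excess 1 t / (- (t\<^sup>2 * ln t)) \<le> b"
proof (rule bounds_from_limit_at_right_0[of r "\<lambda>t. excess 1 t / (- (t\<^sup>2 * ln t))"])
  have ln: "ln t < 0" if "t \<in> {0<..r}" for t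
    using that assms(2) by simp
  show "1 / pi > 0" by simp
  show "continuous_on {0<..r} (\<lambda>t. excess 1 t / (- (t\<^sup>2 * ln t)))"
    using continuous_on_excess[of r 0] ln by (intro continuous_intros) (auto dest!: ln)
  show "excess 1 t / (- (t\<^sup>2 * ln t)) \<noteq> 0" if "t \<in> {0<..r}" for t
    using excess_nonzero[of r 0 t] assms(3) that ln[OF that] by auto
  show "((\<lambda>t. excess 1 t / (- (t\<^sup>2 * ln t))) \<longlongrightarrow> 1 / pi) (at_right 0)"
  proof (rule lhopital_right_0[where f' = "\<lambda>t. - (t * weighted_Y 0 t)" and g' = "\<lambda>t. - (t * (2 * ln t + 1))"])
    show "(excess 1 \<longlongrightarrow> 0) (at_right 0)"
      using excess_tendsto_0[of 2] by simp
    have "((\<lambda>t :: real. - (t * (t * ln t))) \<longlongrightarrow> - (0 * 0)) (at_right 0)"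
      by (intro tendsto_intros t_ln_t_tendsto_0)
    then show "((\<lambda>t :: real. - (t\<^sup>2 * ln t)) \<longlongrightarrow> 0) (at_right 0)"
      by (simp add: power2_eq_square mult.assoc)
    have pos: "\<forall>\<^sub>F t :: real in at_right 0. 0 < t" by (rule eventually_at_right_less)
    have small: "\<forall>\<^sub>F t :: real in at_right 0. ln t < - 1"
      using ln_at_0 by (simp add: filterlim_at_bot_dense)
    show "\<forall>\<^sub>F t :: real in at_right 0. - (t\<^sup>2 * ln t) \<noteq> 0"
         "\<forall>\<^sub>F t :: real in at_right 0. - (t * (2 * ln t + 1)) \<noteq> 0"
      using pos small by (eventually_elim, auto)+
    show "\<forall>\<^sub>F t in at_right 0. (excess 1 has_real_derivative - (t * weighted_Y 0 t)) (at t)"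
      using pos by eventually_elim (use DERIV_excess[of _ 0] in simp)
    show "\<forall>\<^sub>F t in at_right 0. ((\<lambda>t :: real. - (t\<^sup>2 * ln t)) has_real_derivative - (t * (2 * ln t + 1))) (at t)"
      using pos by eventually_elim (auto intro!: derivative_eq_intros simp: power2_eq_square algebra_simps)
    have "((\<lambda>t. weighted_Y 0 t / ln t / (2 + inverse (ln t))) \<longlongrightarrow> 2 / pi / (2 + 0)) (at_right 0)"
      by (intro tendsto_intros weighted_Y_0_over_ln_tendsto inverse_ln_tendsto_0) simp
    moreover have "\<forall>\<^sub>F t in at_right 0. weighted_Y 0 t / ln t / (2 + inverse (ln t)) =
        - (t * weighted_Y 0 t) / (- (t * (2 * ln t + 1)))"
      using pos small
    proof eventually_elim
      case (elim t)
      have "ln t \<noteq> 0" using elim by linarith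
      then have "ln t * (2 + inverse (ln t)) = 2 * ln t + 1"
        unfolding distrib_left by (subst right_inverse) simp_all
      then show ?case using elim by (simp flip: mult.assoc)
    qed
    ultimately have "((\<lambda>t. - (t * weighted_Y 0 t) / (- (t * (2 * ln t + 1)))) \<longlongrightarrow> 2 / pi / (2 + 0)) (at_right 0)"
      by (rule Lim_transform_eventually)
    then show "((\<lambda>t. - (t * weighted_Y 0 t) / (- (t * (2 * ln t + 1)))) \<longlongrightarrow> 1 / pi) (at_right 0)"
      by simp
  qed
qed (use assms(1) that in blast)+

lemma cos_deficit_bounds:
  assumes "0 < r" "r < pi"
  obtains a b :: real where "a > 0" "b > 0"
    "\<And>t. t \<in> {0<..r} \<Longrightarrow> a \<le> (1 - cos t) / t\<^sup>2 \<and> (1 - cos t) / t\<^sup>2 \<le> b"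
proof (rule bounds_from_limit_at_right_0[of r "\<lambda>t. (1 - cos t) / t\<^sup>2"])
  show "(1 / 2 :: real) > 0" by simp
  show "continuous_on {0<..r} (\<lambda>t. (1 - cos t) / t\<^sup>2)"
    by (intro continuous_intros) auto
  show "(1 - cos t) / t\<^sup>2 \<noteq> 0" if "t \<in> {0<..r}" for t
    using cos_monotone_0_pi[of 0 t] that assms(2) by auto
  show "((\<lambda>t :: real. (1 - cos t) / t\<^sup>2) \<longlongrightarrow> 1 / 2) (at_right 0)"
  proof (rule lhopital_right_0[where f' = sin and g' = "\<lambda>t. 2 * t"])
    show "((\<lambda>t :: real. 1 - cos t) \<longlongrightarrow> 0) (at_right 0)" "((\<lambda>t :: real. t\<^sup>2) \<longlongrightarrow> 0) (at_right 0)"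
      by ((rule tendsto_eq_intros refl)+, simp)+
    show "\<forall>\<^sub>F t :: real in at_right 0. t\<^sup>2 \<noteq> 0" "\<forall>\<^sub>F t :: real in at_right 0. 2 * t \<noteq> 0"
      using eventually_at_right_less by (eventually_elim, simp)+
    show "\<forall>\<^sub>F t in at_right 0. ((\<lambda>t :: real. 1 - cos t) has_real_derivative sin t) (at t)"
         "\<forall>\<^sub>F t in at_right 0. ((\<lambda>t :: real. t\<^sup>2) has_real_derivative 2 * t) (at t)"
      by (intro always_eventually allI; auto intro!: derivative_eq_intros)+
    have "((\<lambda>t :: real. sin t / t) \<longlongrightarrow> 1) (at 0)"
      using DERIV_sin[of "0 :: real"] by (simp add: has_field_derivative_iff)
    then have "((\<lambda>t :: real. sin t / t) \<longlongrightarrow> 1) (at_right 0)"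
      by (rule filterlim_mono) (auto intro: at_le)
    then have "((\<lambda>t :: real. sin t / t / 2) \<longlongrightarrow> 1 / 2) (at_right 0)"
      by (intro tendsto_intros) auto
    then show "((\<lambda>t :: real. sin t / (2 * t)) \<longlongrightarrow> 1 / 2) (at_right 0)"
      by (simp add: mult.commute)
  qed
qed (use assms(1) that in blast)+

text \<open>
  The first zero is the infimum of all positive zeros, hence a lower bound for each of them.
\<close>
lemma bessel_Y_nonzero_below_first_zero:
  assumes "r < bessel_Y_first_zero \<nu>" "0 < t" "t \<le> r"
  shows "bessel_Y \<nu> t \<noteq> 0"
  using bessel_Y_first_zero_le[of t \<nu>] assms by force

lemma Psi_minus_Lambda_bounds_ge_5:
  fixes r :: real
  assumes "CARD('n::finite) \<ge> 5" "r > 0" "r < bessel_Y_first_zero ((real CARD('n) - 4) / 2)"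
  shows "\<exists>\<kappa>\<^sub>1>0. \<exists>\<kappa>\<^sub>2>0. \<forall>x :: real ^ 'n. x \<in> ball 0 r - {0} \<longrightarrow>
           \<kappa>\<^sub>1 * norm x powr (4 - real CARD('n)) \<le> Psi x - Lambda x \<and>
           Psi x - Lambda x \<le> \<kappa>\<^sub>2 * norm x powr (4 - real CARD('n))"
proof -
  define j where "j = CARD('n) - 4"
  have j: "CARD('n) = (j + 2) + 2" "j > 0" "(real CARD('n) - 4) / 2 = real j / 2"
    using assms(1) by (auto simp: j_def of_nat_diff)
  define c where "c = 1 / 4 * (2 * pi) powr (- (real (j + 2) / 2))"
  have c: "c > 0" by (simp add: c_def)
  obtain a b where ab: "a > 0" "b > 0"
    "\<And>t. t \<in> {0<..r} \<Longrightarrow> a \<le> excess (real (j + 2) / 2) t / t\<^sup>2 \<and> excess (real (j + 2) / 2) t / t\<^sup>2 \<le> b"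
    using excess_bounds[OF j(2) assms(2)] bessel_Y_nonzero_below_first_zero[OF assms(3)] unfolding j(3) by metis
  have "c * a * norm x powr (4 - real CARD('n)) \<le> Psi x - Lambda x \<and>
        Psi x - Lambda x \<le> c * b * norm x powr (4 - real CARD('n))" if x: "x \<in> ball 0 r - {0}" for x :: "real ^ 'n"
  proof -
    define t where "t = norm x"
    have t: "t \<in> {0<..r}" "t > 0" using x by (auto simp: t_def)
    define w where "w = c * t powr (4 - real CARD('n))"
    have w: "w \<ge> 0" using c by (simp add: w_def)
    have p: "t powr (4 - real CARD('n)) = t powr (2 - real CARD('n)) * t\<^sup>2"
      using t powr_add[of t "2 - real CARD('n)" 2] by (simp add: powr_numeral)
    have "Psi x - Lambda x = c * (t powr (2 - real CARD('n)) * excess (real (j + 2) / 2) t)"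
      unfolding c_def t_def using x j(1) by (intro Psi_minus_Lambda) auto
    also have "\<dots> = w * (excess (real (j + 2) / 2) t / t\<^sup>2)"
      unfolding w_def p using t by simp
    finally have eq: "Psi x - Lambda x = w * (excess (real (j + 2) / 2) t / t\<^sup>2)" .
    have "w * a \<le> Psi x - Lambda x" "Psi x - Lambda x \<le> w * b"
      unfolding eq using ab(3)[OF t(1)] w by (metis mult_left_mono)+
    then show ?thesis
      unfolding w_def t_def by (simp add: mult_ac)
  qed
  then show ?thesis
    using c ab(1,2) by (intro exI[of _ "c * a"] conjI exI[of _ "c * b"]) auto
qed

lemma Psi_minus_Lambda_bounds_4:
  fixes r :: real
  assumes "CARD('n::finite) = 4" "r > 0" "r < bessel_Y_first_zero 0"
  shows "\<exists>\<kappa>\<^sub>1>0. \<exists>\<kappa>\<^sub>2>0. \<forall>x :: real ^ 'n. x \<in> ball 0 r - {0} \<longrightarrow>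
           \<kappa>\<^sub>1 * \<bar>ln (norm x)\<bar> \<le> Psi x - Lambda x \<and> Psi x - Lambda x \<le> \<kappa>\<^sub>2 * \<bar>ln (norm x)\<bar>"
proof -
  define c where "c = 1 / 4 * (2 * pi) powr (- 1)"
  have c: "c > 0" by (simp add: c_def)
  have r1: "r < 1" using assms(3) bessel_Y_first_zero_0_le_1 by linarith
  obtain a b where ab: "a > 0" "b > 0"
    "\<And>t. t \<in> {0<..r} \<Longrightarrow> a \<le> excess 1 t / (- (t\<^sup>2 * ln t)) \<and> excess 1 t / (- (t\<^sup>2 * ln t)) \<le> b"
    using excess_1_bounds[OF assms(2) r1] bessel_Y_nonzero_below_first_zero[OF assms(3)] by metis
  have "c * a * \<bar>ln (norm x)\<bar> \<le> Psi x - Lambda x \<and> Psi x - Lambda x \<le> c * b * \<bar>ln (norm x)\<bar>"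
    if x: "x \<in> ball 0 r - {0}" for x :: "real ^ 'n"
  proof -
    define t where "t = norm x"
    have t: "t \<in> {0<..r}" "t > 0" "ln t < 0" using x r1 by (auto simp: t_def)
    define w where "w = c * \<bar>ln t\<bar>"
    have w: "w \<ge> 0" using c by (simp add: w_def)
    have "Psi x - Lambda x = c * (t powr (- 2) * excess 1 t)"
      using Psi_minus_Lambda[of 2 x] x assms(1) unfolding c_def t_def by simp
    also have "\<dots> = w * (excess 1 t / (- (t\<^sup>2 * ln t)))"
      unfolding w_def using t by (simp add: powr_minus powr_numeral field_simps)
    finally have eq: "Psi x - Lambda x = w * (excess 1 t / (- (t\<^sup>2 * ln t)))" .
    have "w * a \<le> Psi x - Lambda x" "Psi x - Lambda x \<le> w * b"
      unfolding eq using ab(3)[OF t(1)] w by (metis mult_left_mono)+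
    then show ?thesis
      unfolding w_def t_def by (simp add: mult_ac)
  qed
  then show ?thesis
    using c ab(1,2) by (intro exI[of _ "c * a"] conjI exI[of _ "c * b"]) auto
qed

lemma Psi_minus_Lambda_bounds_3:
  fixes r :: real
  assumes "CARD('n::finite) = 3" "r > 0" "r < pi"
  shows "\<exists>\<kappa>\<^sub>1>0. \<exists>\<kappa>\<^sub>2>0. \<forall>x :: real ^ 'n. x \<in> ball 0 r - {0} \<longrightarrow>
           - \<kappa>\<^sub>1 * norm x \<ge> Psi x - Lambda x \<and> Psi x - Lambda x \<ge> - \<kappa>\<^sub>2 * norm x"
proof -
  define c where "c = 1 / 4 * (2 * pi) powr (- (1 / 2))"
  define K :: real where "K = 2 powr (1/2) * Gamma (1/2) / pi"
  have c: "c > 0" by (simp add: c_def)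
  have K: "K > 0" using Gamma_real_pos[of "1/2"] by (simp add: K_def)
  obtain a b where ab: "a > 0" "b > 0"
    "\<And>t. t \<in> {0<..r} \<Longrightarrow> a \<le> (1 - cos t) / t\<^sup>2 \<and> (1 - cos t) / t\<^sup>2 \<le> b"
    using cos_deficit_bounds[OF assms(2,3)] by metis
  have "- (c * K * a) * norm x \<ge> Psi x - Lambda x \<and> Psi x - Lambda x \<ge> - (c * K * b) * norm x"
    if x: "x \<in> ball 0 r - {0}" for x :: "real ^ 'n"
  proof -
    define t where "t = norm x"
    have t: "t \<in> {0<..r}" "t > 0" using x by (auto simp: t_def)
    define w where "w = c * K * t"
    have w: "w \<ge> 0" using c K t by (simp add: w_def)
    have "Psi x - Lambda x = c * (t powr (- 1) * excess (1/2) t)"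
      using Psi_minus_Lambda[of 1 x] x assms(1) unfolding c_def t_def by simp
    also have "excess (1/2) t = - (K * (1 - cos t))"
      unfolding excess_def weighted_Y_one_half[OF t(2)] K_def[symmetric] by (simp add: algebra_simps)
    also have "c * (t powr (- 1) * - (K * (1 - cos t))) = - (w * ((1 - cos t) / t\<^sup>2))"
      unfolding w_def using t by (simp add: powr_minus field_simps power2_eq_square)
    finally have eq: "Psi x - Lambda x = - (w * ((1 - cos t) / t\<^sup>2))" .
    have "w * a \<le> w * ((1 - cos t) / t\<^sup>2)" "w * ((1 - cos t) / t\<^sup>2) \<le> w * b"
      using ab(3)[OF t(1)] w by (metis mult_left_mono)+
    then show ?thesis
      unfolding eq unfolding w_def t_def by (simp add: mult_ac)
  qed
  then show ?thesis
    using c K ab(1,2) by (intro exI[of _ "c * K * a"] conjI exI[of _ "c * K * b"]) auto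
qed

lemma Psi_minus_Lambda_multi_deriv_bound:
  fixes r :: real
  assumes "CARD('n::finite) \<ge> 3" "r > 0" "m \<ge> 1"
  shows "\<exists>\<kappa>>0. \<forall>\<alpha> :: 'n \<Rightarrow> nat. multi_order \<alpha> = m \<longrightarrow> (\<forall>x :: real ^ 'n. x \<in> ball 0 r - {0} \<longrightarrow>
    \<bar>multi_deriv \<alpha> (\<lambda>y. Psi y - Lambda y) x\<bar> \<le> \<kappa> * norm x powr (4 - real CARD('n) - real (multi_order \<alpha>)))"
proof (cases "CARD('n) = 3")
  case True
  then have cls: "singular_class (4 - real CARD('n)) (\<lambda>x :: real ^ 'n. Psi x - Lambda x)"
    using Psi_minus_Lambda_class[where 'n = 'n] by simp
  show ?thesis
  proof (rule multi_deriv_class_bound[where P = singular_class])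
    show "singular_class (p - 1) (partial_deriv i F)" if "singular_class p F" for p i and F :: "real ^ 'n \<Rightarrow> real"
      using that by (rule singular_class_partial_deriv)
    show "\<exists>C\<ge>0. \<forall>x. x \<noteq> 0 \<longrightarrow> norm x < r \<longrightarrow> \<bar>G x\<bar> \<le> C * norm x powr (4 - real CARD('n) - real m)"
      if "singular_class (4 - real CARD('n) - real m) G" for G :: "real ^ 'n \<Rightarrow> real"
      using that by (rule singular_class_bound) (use True assms in auto)
    show "singular_class (4 - real CARD('n)) (\<lambda>x :: real ^ 'n. Psi x - Lambda x)"
      by (rule cls)
  qed
next
  case False
  then have cls: "log_singular_class (4 - real CARD('n)) (\<lambda>x :: real ^ 'n. Psi x - Lambda x)"
    using Psi_minus_Lambda_class[where 'n = 'n] assms(1) by simp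
  show ?thesis
  proof (rule multi_deriv_class_bound[where P = log_singular_class])
    show "log_singular_class (p - 1) (partial_deriv i F)" if "log_singular_class p F" for p i and F :: "real ^ 'n \<Rightarrow> real"
      using that by (rule log_singular_class_partial_deriv)
    show "\<exists>C\<ge>0. \<forall>x. x \<noteq> 0 \<longrightarrow> norm x < r \<longrightarrow> \<bar>G x\<bar> \<le> C * norm x powr (4 - real CARD('n) - real m)"
      if "log_singular_class (4 - real CARD('n) - real m) G" for G :: "real ^ 'n \<Rightarrow> real"
      using that by (rule log_singular_class_bound) (use False assms in auto)
    show "log_singular_class (4 - real CARD('n)) (\<lambda>x :: real ^ 'n. Psi x - Lambda x)"
      by (rule cls)
  qed
qed

theorem lemma2p1:
  fixes r :: real
  assumes "CARD('n::finite) \<ge> 3"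
    and "r > 0"
    and "CARD('n) \<ge> 4 \<Longrightarrow> r < bessel_Y_first_zero ((real CARD('n) - 4) / 2)"
    and "CARD('n) = 3 \<Longrightarrow> r < pi"
  shows
    "(\<exists>\<kappa>\<^sub>1>0. \<exists>\<kappa>\<^sub>2>0. \<forall>x :: real ^ 'n. x \<in> ball 0 r - {0} \<longrightarrow>
        (CARD('n) \<ge> 5 \<longrightarrow>
           \<kappa>\<^sub>1 * norm x powr (4 - real CARD('n)) \<le> Psi x - Lambda x \<and>
           Psi x - Lambda x \<le> \<kappa>\<^sub>2 * norm x powr (4 - real CARD('n))) \<and>
        (CARD('n) = 4 \<longrightarrow>
           \<kappa>\<^sub>1 * \<bar>ln (norm x)\<bar> \<le> Psi x - Lambda x \<and>
           Psi x - Lambda x \<le> \<kappa>\<^sub>2 * \<bar>ln (norm x)\<bar>) \<and>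
        (CARD('n) = 3 \<longrightarrow>
           - \<kappa>\<^sub>1 * norm x \<ge> Psi x - Lambda x \<and>
           Psi x - Lambda x \<ge> - \<kappa>\<^sub>2 * norm x))
     \<and>
     (\<forall>m::nat. m \<ge> 1 \<longrightarrow> (\<exists>\<kappa>\<^sub>3>0. \<forall>\<alpha> :: 'n \<Rightarrow> nat. multi_order \<alpha> = m \<longrightarrow>
        (\<forall>x :: real ^ 'n. x \<in> ball 0 r - {0} \<longrightarrow>
           \<bar>multi_deriv \<alpha> (\<lambda>y. Psi y - Lambda y) x\<bar>
             \<le> \<kappa>\<^sub>3 * norm x powr (4 - real CARD('n) - real (multi_order \<alpha>)))))"
proof (intro conjI allI impI)
  consider "CARD('n) \<ge> 5" | "CARD('n) = 4" | "CARD('n) = 3"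
    using assms(1) by linarith
  then show "\<exists>\<kappa>\<^sub>1>0. \<exists>\<kappa>\<^sub>2>0. \<forall>x :: real ^ 'n. x \<in> ball 0 r - {0} \<longrightarrow>
        (CARD('n) \<ge> 5 \<longrightarrow>
           \<kappa>\<^sub>1 * norm x powr (4 - real CARD('n)) \<le> Psi x - Lambda x \<and>
           Psi x - Lambda x \<le> \<kappa>\<^sub>2 * norm x powr (4 - real CARD('n))) \<and>
        (CARD('n) = 4 \<longrightarrow>
           \<kappa>\<^sub>1 * \<bar>ln (norm x)\<bar> \<le> Psi x - Lambda x \<and>
           Psi x - Lambda x \<le> \<kappa>\<^sub>2 * \<bar>ln (norm x)\<bar>) \<and>
        (CARD('n) = 3 \<longrightarrow>
           - \<kappa>\<^sub>1 * norm x \<ge> Psi x - Lambda x \<and>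
           Psi x - Lambda x \<ge> - \<kappa>\<^sub>2 * norm x)"
  proof cases
    case 1
    then show ?thesis
      using Psi_minus_Lambda_bounds_ge_5[where 'n = 'n and r = r] assms(2,3) by simp
  next
    case 2
    then show ?thesis
      using Psi_minus_Lambda_bounds_4[where 'n = 'n and r = r] assms(2,3) by simp
  next
    case 3
    then show ?thesis
      using Psi_minus_Lambda_bounds_3[where 'n = 'n and r = r] assms(2,4) by simp
  qed
next
  fix m :: nat
  assume "m \<ge> 1"
  then show "\<exists>\<kappa>\<^sub>3>0. \<forall>\<alpha> :: 'n \<Rightarrow> nat. multi_order \<alpha> = m \<longrightarrow>
        (\<forall>x :: real ^ 'n. x \<in> ball 0 r - {0} \<longrightarrow>
           \<bar>multi_deriv \<alpha> (\<lambda>y. Psi y - Lambda y) x\<bar>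
             \<le> \<kappa>\<^sub>3 * norm x powr (4 - real CARD('n) - real (multi_order \<alpha>)))"
    by (rule Psi_minus_Lambda_multi_deriv_bound[OF assms(1,2)])
qed

end
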